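(* For all formulas $\alpha,\beta$: (1) $\sqrt{id}\sqrt{id}\,\alpha\equiv\alpha$; (2) $\sqrt{id}\,\mathbf f\equiv\sqrt{id}\,\mathbf t$; (3) $\lnot\sqrt{id}\,\mathbf f\equiv\sqrt{id}\,\mathbf f$ and $\lnot\sqrt{id}\,\mathbf t\equiv\sqrt{id}\,\mathbf t$; (4) $\sqrt{id}(\alpha\land\beta)\equiv\sqrt{id}\,\mathbf f$; (5) $\sqrt\lnot\sqrt\lnot\,\alpha\equiv\lnot\alpha$; (6) $\sqrt\lnot\,\mathbf f\equiv\sqrt\lnot\,\mathbf t$; (7) $\lnot\sqrt\lnot\,\mathbf f\equiv\sqrt\lnot\,\mathbf f$ and $\lnot\sqrt\lnot\,\mathbf t\equiv\sqrt\lnot\,\mathbf t$; (8) $\lnot\sqrt\lnot\,\alpha\equiv\sqrt\lnot\lnot\alpha$; (9) $\sqrt\lnot(\alpha\land\beta)\equiv\sqrt\lnot\,\mathbf f$; (10) $\sqrt{id}\sqrt\lnot\,\alpha\equiv\sqrt{id}\,\alpha$; (11) $\sqrt\lnot\sqrt{id}\,\alpha\equiv\lnot\sqrt\lnot\,\alpha$; (12) $\sqrt{id}\sqrt\lnot(\alpha\land\beta)\equiv\sqrt\lnot\,\mathbf f$; (13) $\sqrt\lnot\sqrt{id}(\alpha\land\beta)\equiv\sqrt\lnot\,\mathbf f$.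
   Context: Hilbert spaces and states: for $n\ge1$, $\mathcal H^{(n)}=(\mathbb C^2)^{\otimes n}$ with canonical basis $|x_1,\dots,x_n\rangle$ ($x_i\in\{0,1\}$, $|0\rangle=(1,0)$, $|1\rangle=(0,1)$); $\mathfrak D(\mathcal H^{(n)})$ is the set of density operators (qumixes). A truth-perspective is a unitary $\mathfrak T$ on $\mathbb C^2$, $\mathfrak T^{(n)}=\mathfrak T^{\otimes n}$. $^{\mathfrak T}P_1^{(n)}$ (resp. $^{\mathfrak T}P_0^{(n)}$) is the projection onto the span of the $\mathfrak T^{(n)}|x_1,\dots,x_n\rangle$ with $x_n=1$ (resp. $0$). $\mathtt p_{\mathfrak T}(\rho)=\mathrm{tr}(^{\mathfrak T}P_1^{(n)}\rho)$, and $\rho\preceq_{\mathfrak T}\sigma$ iff $\mathtt p_{\mathfrak T}(\rho)\le\mathtt p_{\mathfrak T}(\sigma)$. $Red^{(j_1,\dots,j_s)}_{[n_1,\dots,n_t]}(\rho)$ is the reduced state of $\rho$ on factors $j_1,\dots,j_s$ of $\mathcal H^{(n_1)}\otimes\cdots\otimes\mathcal H^{(n_t)}$. Gates (canonical basis, extended linearly): $\mathtt{NOT}^{(n)}|x_1..x_n\rangle=|x_1..x_{n-1}\rangle\otimes|1-x_n\rangle$; $\sqrt{\mathtt I}^{(n)}|x_1..x_n\rangle=|x_1..x_{n-1}\rangle\otimes\frac1{\sqrt2}((-1)^{x_n}|x_n\rangle+|1-x_n\rangle)$; $\sqrt{\mathtt{NOT}}^{(n)}|x_1..x_n\rangle=|x_1..x_{n-1}\rangle\otimes(\frac{1-i}2|x_n\rangle+\frac{1+i}2|1-x_n\rangle)$;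 $\mathtt{XOR}^{(m,n)}|x_1..x_m,y_1..y_n\rangle=|x_1..x_m,y_1..y_{n-1}\rangle\otimes|x_m\oplus y_n\rangle$; $\mathtt T^{(m,n,p)}|x_1..x_m,y_1..y_n,z_1..z_p\rangle=|x_1..x_m,y_1..y_n,z_1..z_{p-1}\rangle\otimes|x_my_n\oplus z_p\rangle$ ($\oplus$ addition mod 2). For a gate $G$ on $\mathcal H^{(n)}$: $G_{\mathfrak T}=\mathfrak T^{(n)}G\mathfrak T^{(n)\dagger}$, $^{\mathfrak D}G_{\mathfrak T}(\rho)=G_{\mathfrak T}\rho G_{\mathfrak T}^\dagger$. Language: formulas built from atomic formulas (including distinguished atoms $\mathbf t,\mathbf f$) with unary $\lnot,\sqrt{id},\sqrt\lnot$, binary $\uplus$, ternary $\intercal$; $\alpha\land\beta:=\intercal(\alpha,\beta,\mathbf f)$. $At(\alpha)$ = number of occurrences of atomic formulas in $\alpha$. Syntactical tree: $Level_1^\alpha=(\alpha)$; $Level_{i+1}^\alpha$ is obtained from $Level_i^\alpha=(\beta_1,\dots,\beta_r)$ by replacing each non-atomic $\beta_j$ by its immediate subformulas (arguments, in order) and keeping atomic $\beta_j$; the last level $Level_h^\alpha$ lists all atomic occurrences. $\mathcal H^{(At\alpha)}=\bigotimes_j\mathcal H^{(At\beta_j)}$. The $\mathfrak T$-gate $G^\alpha_{\mathfrak T(i)}$ ($1\le i<h$) is the tensor product over $j$ of: identity of $\mathbb C^2$ if $\beta_j$ atomic; $\mathtt{NOT}_{\mathfrak T}^{(At\beta)}$,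 $\sqrt{\mathtt I}_{\mathfrak T}^{(At\beta)}$, $\sqrt{\mathtt{NOT}}_{\mathfrak T}^{(At\beta)}$ for $\lnot\beta,\sqrt{id}\beta,\sqrt\lnot\beta$; $\mathtt{XOR}_{\mathfrak T}^{(At\beta',At\beta'')}$ for $\beta'\uplus\beta''$; $\mathtt T_{\mathfrak T}^{(At\beta',At\beta'',At\beta''')}$ for $\intercal(\beta',\beta'',\beta''')$. Holistic model: a map $\mathtt{Hol}_{\mathfrak T}$ assigning to each level $Level_i^\alpha$ of each formula $\alpha$ a qumix in $\mathfrak D(\mathcal H^{(At\alpha)})$ such that (a) $\mathtt{Hol}_{\mathfrak T}(Level_i^\alpha)={}^{\mathfrak D}G^\alpha_{\mathfrak T(i)}(\mathtt{Hol}_{\mathfrak T}(Level_{i+1}^\alpha))$ for $1\le i<h$; (b) (normality) for each $\gamma$, with the contextual meaning of the occurrence $\beta_j$ in $Level_i^\gamma=(\beta_1,\dots,\beta_r)$ defined as $Red^{(j)}_{[At\beta_1,\dots,At\beta_r]}(\mathtt{Hol}_{\mathfrak T}(Level_i^\gamma))$, all occurrences of the same subformula $\beta$ in the tree of $\gamma$ have the same contextual meaning, denoted $\mathtt{Hol}^\gamma_{\mathfrak T}(\beta)$; (c) every occurrence of $\mathbf f$ (resp. $\mathbf t$) has contextual meaning $^{\mathfrak T}P_0^{(1)}$ (resp. $^{\mathfrak T}P_1^{(1)}$). Logical consequence: $\alpha\vDash\beta$ iff for every truth-perspective $\mathfrak T$, every formula $\gamma$ having both $\alpha$ and $\beta$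 as subformulas (a formula counts as a subformula of itself), and every holistic model $\mathtt{Hol}_{\mathfrak T}$, $\mathtt{Hol}^\gamma_{\mathfrak T}(\alpha)\preceq_{\mathfrak T}\mathtt{Hol}^\gamma_{\mathfrak T}(\beta)$. $\alpha\equiv\beta$ means $\alpha\vDash\beta$ and $\beta\vDash\alpha$. *)

theory Defs
  imports Complex_Main "Jordan_Normal_Form.Matrix"
begin

text \<open>Operators on H^(n) = (C^2)^{\<otimes>n} are complex 2^n x 2^n matrices w.r.t. the canonical
  basis. The basis vector |x_1,...,x_n> has index sum_i x_i 2^(n-i), i.e. x_1 is the most
  significant bit and x_n is the least significant bit (x_n = index mod 2).
  The tensor product is the Kronecker product, first factor most significant.\<close>

definition adj :: "complex mat \<Rightarrow> complex mat" where
  "adj A = mat (dim_col A) (dim_row A) (\<lambda>(i, j). cnj (A $$ (j, i)))"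

definition mtrace :: "complex mat \<Rightarrow> complex" where
  "mtrace A = (\<Sum>i<dim_row A. A $$ (i, i))"

definition kron :: "complex mat \<Rightarrow> complex mat \<Rightarrow> complex mat" where
  "kron A B = mat (dim_row A * dim_row B) (dim_col A * dim_col B)
     (\<lambda>(i, j). A $$ (i div dim_row B, j div dim_col B) * B $$ (i mod dim_row B, j mod dim_col B))"

fun kpow :: "complex mat \<Rightarrow> nat \<Rightarrow> complex mat" where
  "kpow U 0 = 1\<^sub>m 1"
| "kpow U (Suc n) = kron (kpow U n) U"

definition density :: "nat \<Rightarrow> complex mat \<Rightarrow> bool" where
  "density d \<rho> \<longleftrightarrow> \<rho> \<in> carrier_mat d d \<and> adj \<rho> = \<rho> \<and>
     (\<forall>v \<in> carrier_vec d. Im (\<Sum>i<d. cnj (v $ i) * (\<rho> *\<^sub>v v) $ i) = 0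
                          \<and> 0 \<le> Re (\<Sum>i<d. cnj (v $ i) * (\<rho> *\<^sub>v v) $ i)) \<and>
     mtrace \<rho> = 1"

definition truth_perspective :: "complex mat \<Rightarrow> bool" where
  "truth_perspective T \<longleftrightarrow> T \<in> carrier_mat 2 2 \<and> T * adj T = 1\<^sub>m 2 \<and> adj T * T = 1\<^sub>m 2"

text \<open>T P_1^(n) (resp. T P_0^(n)): projection onto the span of the orthonormal vectors
  T^(n)|x_1..x_n> with x_n = 1 (resp. 0); T^(n)|x> is the column of index x of kpow T n,
  and the projection onto the span of orthonormal vectors is the sum of their outer products.\<close>
definition projT :: "complex mat \<Rightarrow> nat \<Rightarrow> bool \<Rightarrow> complex mat" where
  "projT T n b = mat (2^n) (2^n) (\<lambda>(r, s).
      \<Sum>k \<in> {k. k < 2^n \<and> odd k = b}. kpow T n $$ (r, k) * cnj (kpow T n $$ (s, k)))"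

definition P1 :: "complex mat \<Rightarrow> nat \<Rightarrow> complex mat" where "P1 T n = projT T n True"
definition P0 :: "complex mat \<Rightarrow> nat \<Rightarrow> complex mat" where "P0 T n = projT T n False"

text \<open>Probability value p_T(\<rho>) = tr(T P_1^(n) \<rho>) (a real number for qumixes).\<close>
definition probT :: "complex mat \<Rightarrow> nat \<Rightarrow> complex mat \<Rightarrow> real" where
  "probT T n \<rho> = Re (mtrace (P1 T n * \<rho>))"

text \<open>A gate on n qubits given by its action on basis vectors:
  f x y = coefficient of |y> in G|x>.\<close>
definition gate_of :: "nat \<Rightarrow> (nat \<Rightarrow> nat \<Rightarrow> complex) \<Rightarrow> complex mat" where
  "gate_of n f = mat (2^n) (2^n) (\<lambda>(y, x). f x y)"

definition flip :: "nat \<Rightarrow> nat" where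
  "flip k = (if even k then k + 1 else k - 1)"

definition NOT_gate :: "nat \<Rightarrow> complex mat" where
  "NOT_gate n = gate_of n (\<lambda>x y. if y = flip x then 1 else 0)"

definition sqrtI_gate :: "nat \<Rightarrow> complex mat" where
  "sqrtI_gate n = gate_of n (\<lambda>x y.
     if y = x then (-1) ^ (x mod 2) / complex_of_real (sqrt 2)
     else if y = flip x then 1 / complex_of_real (sqrt 2) else 0)"

definition sqrtNOT_gate :: "nat \<Rightarrow> complex mat" where
  "sqrtNOT_gate n = gate_of n (\<lambda>x y.
     if y = x then (1 - \<i>) / 2 else if y = flip x then (1 + \<i>) / 2 else 0)"

text \<open>XOR^(m,n): index x = a*2^n + b with x_m = a mod 2 (bit n of x) and y_n = b mod 2
  (bit 0 of x); the last bit becomes x_m xor y_n.\<close>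
definition XOR_gate :: "nat \<Rightarrow> nat \<Rightarrow> complex mat" where
  "XOR_gate m n = gate_of (m + n) (\<lambda>x y.
     if y = (if odd (x div 2^n) then flip x else x) then 1 else 0)"

text \<open>Toffoli T^(m,n,p): x_m is bit (n+p) of the index, y_n is bit p, z_p is bit 0;
  the last bit becomes x_m y_n xor z_p.\<close>
definition Toffoli_gate :: "nat \<Rightarrow> nat \<Rightarrow> nat \<Rightarrow> complex mat" where
  "Toffoli_gate m n p = gate_of (m + n + p) (\<lambda>x y.
     if y = (if odd (x div 2^(n + p)) \<and> odd (x div 2^p) then flip x else x) then 1 else 0)"

definition gateT :: "complex mat \<Rightarrow> nat \<Rightarrow> complex mat \<Rightarrow> complex mat" where
  "gateT T n G = kpow T n * G * adj (kpow T n)"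

datatype form =
    Atom nat
  | TT
  | FF
  | Neg form
  | SqId form
  | SqNeg form
  | Xor form form
  | Tof form form form

definition conj :: "form \<Rightarrow> form \<Rightarrow> form" where
  "conj a b = Tof a b FF"

fun is_atomic :: "form \<Rightarrow> bool" where
  "is_atomic (Atom _) = True"
| "is_atomic TT = True"
| "is_atomic FF = True"
| "is_atomic _ = False"

fun At :: "form \<Rightarrow> nat" where
  "At (Atom _) = 1"
| "At TT = 1"
| "At FF = 1"
| "At (Neg a) = At a"
| "At (SqId a) = At a"
| "At (SqNeg a) = At a"
| "At (Xor a b) = At a + At b"
| "At (Tof a b c) = At a + At b + At c"

fun subforms :: "form \<Rightarrow> form set" where
  "subforms (Neg a) = insert (Neg a) (subforms a)"
| "subforms (SqId a) = insert (SqId a) (subforms a)"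
| "subforms (SqNeg a) = insert (SqNeg a) (subforms a)"
| "subforms (Xor a b) = insert (Xor a b) (subforms a \<union> subforms b)"
| "subforms (Tof a b c) = insert (Tof a b c) (subforms a \<union> subforms b \<union> subforms c)"
| "subforms a = {a}"

fun expand :: "form \<Rightarrow> form list" where
  "expand (Neg a) = [a]"
| "expand (SqId a) = [a]"
| "expand (SqNeg a) = [a]"
| "expand (Xor a b) = [a, b]"
| "expand (Tof a b c) = [a, b, c]"
| "expand a = [a]"

text \<open>Level_i^\<alpha> for i \<ge> 1 (Level_1 = (\<alpha>)).\<close>
definition level :: "form \<Rightarrow> nat \<Rightarrow> form list" where
  "level \<alpha> i = ((\<lambda>l. concat (map expand l)) ^^ (i - 1)) [\<alpha>]"

text \<open>Height h of the syntactical tree: the index of the last level (all atomic).\<close>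
fun height :: "form \<Rightarrow> nat" where
  "height (Neg a) = Suc (height a)"
| "height (SqId a) = Suc (height a)"
| "height (SqNeg a) = Suc (height a)"
| "height (Xor a b) = Suc (max (height a) (height b))"
| "height (Tof a b c) = Suc (max (height a) (max (height b) (height c)))"
| "height a = 1"

fun entry_gate :: "complex mat \<Rightarrow> form \<Rightarrow> complex mat" where
  "entry_gate T (Neg b) = gateT T (At b) (NOT_gate (At b))"
| "entry_gate T (SqId b) = gateT T (At b) (sqrtI_gate (At b))"
| "entry_gate T (SqNeg b) = gateT T (At b) (sqrtNOT_gate (At b))"
| "entry_gate T (Xor b c) = gateT T (At b + At c) (XOR_gate (At b) (At c))"
| "entry_gate T (Tof b c d) = gateT T (At b + At c + At d) (Toffoli_gate (At b) (At c) (At d))"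
| "entry_gate T b = 1\<^sub>m 2"

definition level_gate :: "complex mat \<Rightarrow> form \<Rightarrow> nat \<Rightarrow> complex mat" where
  "level_gate T \<alpha> i = foldl kron (1\<^sub>m 1) (map (entry_gate T) (level \<alpha> i))"

text \<open>Red^(j)_[n_1..n_t](\<rho>) (factors indexed from 0 here): partial trace over all
  factors except the j-th.\<close>
definition red :: "nat list \<Rightarrow> nat \<Rightarrow> complex mat \<Rightarrow> complex mat" where
  "red ns j \<rho> =
    (let a = 2 ^ sum_list (take j ns); b = 2 ^ (ns ! j); c = 2 ^ sum_list (drop (Suc j) ns)
     in mat b b (\<lambda>(y, x). \<Sum>u<a. \<Sum>w<c. \<rho> $$ ((u * b + y) * c + w, (u * b + x) * c + w)))"

definition ctx :: "(form \<Rightarrow> nat \<Rightarrow> complex mat) \<Rightarrow> form \<Rightarrow> nat \<Rightarrow> nat \<Rightarrow> complex mat" where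
  "ctx Hol \<gamma> i j = red (map At (level \<gamma> i)) j (Hol \<gamma> i)"

definition is_pos :: "form \<Rightarrow> nat \<Rightarrow> nat \<Rightarrow> bool" where
  "is_pos \<gamma> i j \<longleftrightarrow> 1 \<le> i \<and> i \<le> height \<gamma> \<and> j < length (level \<gamma> i)"

text \<open>Holistic model w.r.t. truth-perspective T: Hol \<gamma> i is the qumix assigned to Level_i^\<gamma>.\<close>
definition holistic :: "complex mat \<Rightarrow> (form \<Rightarrow> nat \<Rightarrow> complex mat) \<Rightarrow> bool" where
  "holistic T Hol \<longleftrightarrow>
     (\<forall>\<gamma> i. 1 \<le> i \<and> i \<le> height \<gamma> \<longrightarrow> density (2 ^ At \<gamma>) (Hol \<gamma> i)) \<and>
     (\<forall>\<gamma> i. 1 \<le> i \<and> i < height \<gamma> \<longrightarrow>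
        Hol \<gamma> i = level_gate T \<gamma> i * Hol \<gamma> (Suc i) * adj (level_gate T \<gamma> i)) \<and>
     (\<forall>\<gamma> i j i' j'. is_pos \<gamma> i j \<and> is_pos \<gamma> i' j' \<and> level \<gamma> i ! j = level \<gamma> i' ! j' \<longrightarrow>
        ctx Hol \<gamma> i j = ctx Hol \<gamma> i' j') \<and>
     (\<forall>\<gamma> i j. is_pos \<gamma> i j \<and> level \<gamma> i ! j = FF \<longrightarrow> ctx Hol \<gamma> i j = P0 T 1) \<and>
     (\<forall>\<gamma> i j. is_pos \<gamma> i j \<and> level \<gamma> i ! j = TT \<longrightarrow> ctx Hol \<gamma> i j = P1 T 1)"

text \<open>Hol^\<gamma>_T(\<beta>): the (common) contextual meaning of the occurrences of \<beta> in the tree of \<gamma>.\<close>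
definition hol_meaning :: "(form \<Rightarrow> nat \<Rightarrow> complex mat) \<Rightarrow> form \<Rightarrow> form \<Rightarrow> complex mat" where
  "hol_meaning Hol \<gamma> \<beta> = (SOME \<rho>. \<exists>i j. is_pos \<gamma> i j \<and> level \<gamma> i ! j = \<beta> \<and> \<rho> = ctx Hol \<gamma> i j)"

definition consequence :: "form \<Rightarrow> form \<Rightarrow> bool" (infix \<open>\<Turnstile>\<^sub>q\<close> 50) where
  "\<alpha> \<Turnstile>\<^sub>q \<beta> \<longleftrightarrow>
     (\<forall>T \<gamma> Hol. truth_perspective T \<and> \<alpha> \<in> subforms \<gamma> \<and> \<beta> \<in> subforms \<gamma> \<and> holistic T Hol \<longrightarrow>
        probT T (At \<alpha>) (hol_meaning Hol \<gamma> \<alpha>) \<le> probT T (At \<beta>) (hol_meaning Hol \<gamma> \<beta>))"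

definition qequiv :: "form \<Rightarrow> form \<Rightarrow> bool" (infix \<open>\<equiv>\<^sub>q\<close> 50) where
  "\<alpha> \<equiv>\<^sub>q \<beta> \<longleftrightarrow> \<alpha> \<Turnstile>\<^sub>q \<beta> \<and> \<beta> \<Turnstile>\<^sub>q \<alpha>"

end

theory Submission
  imports Defs
begin

text \<open>The contextual meaning of \<open>\<phi>\<close>, rotated into the basis of \<open>T\<close> and reduced to its last qubit,
  is a \<open>2 \<times> 2\<close> matrix \<open>state \<phi>\<close> whose entry \<open>(1, 1)\<close> is the probability of \<open>\<phi>\<close>. Since every
  level gate is a tensor product of isometries, taking the reduced state of one factor commutes with
  the gates of the others; hence negation and the two square roots act on \<open>state\<close> by conjugation
  with the corresponding one-qubit gate. A conjunction has a diagonal \<open>state\<close>, because the third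
  argument of its Toffoli gate is in a pure state. Each law then becomes an identity between
  \<open>2 \<times> 2\<close> matrix entries.\<close>

section \<open>Traces and Kronecker products\<close>

text \<open>Entanglement is the obstacle. The arguments of a Toffoli gate may be correlated with
  each other and with the rest of the level, so the state of a conjunction is not a function of the
  states of its arguments. All that is known locally is that the reduced state of the third argument
  is \<open>P0\<close>. Positivity turns this into an identity for the whole level: a positive
  operator rho with tr (E rho) = 0, for a projection E, satisfies rho E = 0. Reduced states are
  compared by duality: \<open>ptr\<close> is adjoint to \<open>emb\<close> under the pairing tr (M
  rho), so gates are moved from the state to a test matrix M, where isometries on the other factors
  cancel. In Bloch coordinates the probability is an affine function of z. \<open>sqrtI_mat\<close>
  is the Hadamard matrix: it exchanges x and z and negates y. \<open>sqrtNOT_mat\<close> and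
  \<open>not_mat\<close> are, up to a phase, rotations about the x-axis by a quarter and a half
  turn. Every law compares z-coordinates; a conjunction has x = y = 0, which either square root
  sends to z = 0, that is, probability 1/2.\<close>

lemma sum_lessThan_mult:
  fixes f :: "nat \<Rightarrow> 'a::comm_monoid_add"
  shows "(\<Sum>k<m * n. f k) = (\<Sum>i<m. \<Sum>j<n. f (i * n + j))"
proof -
  have "sum f {i * n..<i * n + n} = (\<Sum>j<n. f (i * n + j))" for i
    using sum.shift_bounds_nat_ivl[of f 0 "i * n" n]
    by (simp add: atLeast0LessThan add.commute)
  then show ?thesis
    using sum.nat_group[of f n m] by simp
qed

lemma mult_add_less:
  fixes i j m n :: nat
  assumes "i < m" "j < n"
  shows "i * n + j < m * n"
proof -
  have "i * n + j < Suc i * n" using assms(2) by simp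
  also have "\<dots> \<le> m * n" using assms(1) by (intro mult_le_mono1) simp
  finally show ?thesis .
qed

lemma div_less_factor: "i < m * n \<Longrightarrow> i div n < m" for i m n :: nat
  by (rule less_mult_imp_div_less)

lemma mod_less_factor: "i < m * n \<Longrightarrow> i mod n < n" for i m n :: nat
  by (cases "n = 0") auto

text \<open>Stated by dimension equations instead of \<open>carrier_mat\<close>, so that the
  simplifier can discharge the premises from the dimension rules.\<close>

lemma assoc_mult_mat_dim:
  "dim_col A = dim_row B \<Longrightarrow> dim_col B = dim_row C \<Longrightarrow> A * B * C = A * (B * C)"
  by (rule assoc_mult_mat[of A "dim_row A" "dim_row B" B "dim_row C" C "dim_col C"]) auto

lemma mult_mat_one_left: "dim_row A = n \<Longrightarrow> 1\<^sub>m n * A = A" for A :: "'a::semiring_1 mat"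
  by (rule left_mult_one_mat[of _ _ "dim_col A"]) auto

lemma mult_mat_one_right: "dim_col A = n \<Longrightarrow> A * 1\<^sub>m n = A" for A :: "'a::semiring_1 mat"
  by (rule right_mult_one_mat[of _ "dim_row A"]) auto

lemma dim_adj [simp]: "dim_row (adj A) = dim_col A" "dim_col (adj A) = dim_row A"
  by (auto simp: adj_def)

lemma index_adj [simp]: "i < dim_col A \<Longrightarrow> j < dim_row A \<Longrightarrow> adj A $$ (i, j) = cnj (A $$ (j, i))"
  by (simp add: adj_def)

lemma adj_adj [simp]: "adj (adj A) = A"
  by (rule eq_matI) auto

lemma adj_one [simp]: "adj (1\<^sub>m n) = 1\<^sub>m n"
  by (rule eq_matI) auto

lemma mult_mat_index_sum:
  "i < dim_row A \<Longrightarrow> j < dim_col B \<Longrightarrow> dim_col A = dim_row B \<Longrightarrow>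
    (A * B) $$ (i, j) = (\<Sum>k<dim_row B. A $$ (i, k) * B $$ (k, j))"
  by (simp add: scalar_prod_def atLeast0LessThan)

lemma adj_mult: "dim_col A = dim_row B \<Longrightarrow> adj (A * B) = adj B * adj A"
  by (rule eq_matI) (auto simp: mult_mat_index_sum mult.commute simp del: index_mult_mat(1))

lemma mtrace_mult:
  assumes "dim_col A = dim_row B" "dim_col B = dim_row A"
  shows "mtrace (A * B) = (\<Sum>i<dim_row A. \<Sum>j<dim_row B. A $$ (i, j) * B $$ (j, i))"
  using assms by (simp add: mtrace_def mult_mat_index_sum del: index_mult_mat(1))

lemma mtrace_comm:
  assumes "dim_col A = dim_row B" "dim_col B = dim_row A"
  shows "mtrace (A * B) = mtrace (B * A)"
  using assms by (simp add: mtrace_mult mult.commute sum.swap[of _ _ "{..<dim_row A}"])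

lemma mtrace_add:
  "dim_row A = dim_row B \<Longrightarrow> dim_col B = dim_row B \<Longrightarrow> mtrace (A + B) = mtrace A + mtrace B"
  by (simp add: mtrace_def sum.distrib)

lemma mtrace_zero [simp]: "mtrace (0\<^sub>m n n) = 0"
  by (simp add: mtrace_def)

lemma dim_kron [simp]:
  "dim_row (kron A B) = dim_row A * dim_row B" "dim_col (kron A B) = dim_col A * dim_col B"
  by (auto simp: kron_def)

lemma index_kron:
  "i < dim_row A * dim_row B \<Longrightarrow> j < dim_col A * dim_col B \<Longrightarrow>
    kron A B $$ (i, j)
      = A $$ (i div dim_row B, j div dim_col B) * B $$ (i mod dim_row B, j mod dim_col B)"
  by (simp add: kron_def)

text \<open>The summation index of the left side splits into a quotient and a remainder, and the
  resulting double sum factors. This mixed-product rule is what makes operators on different factors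
  independent.\<close>

lemma kron_mult:
  assumes "dim_col A = dim_row C" "dim_col B = dim_row D"
  shows "kron A B * kron C D = kron (A * C) (B * D)"
proof (rule eq_matI)
  fix i j
  assume ij: "i < dim_row (kron (A * C) (B * D))" "j < dim_col (kron (A * C) (B * D))"
  let ?r = "dim_row B" and ?s = "dim_col D"
  have lt: "i div ?r < dim_row A" "i mod ?r < ?r" "j div ?s < dim_col C" "j mod ?s < ?s"
    using ij by (auto intro: div_less_factor mod_less_factor)
  have "(kron A B * kron C D) $$ (i, j)
      = (\<Sum>k<dim_row C * dim_row D. kron A B $$ (i, k) * kron C D $$ (k, j))"
    using ij assms by (simp add: mult_mat_index_sum del: index_mult_mat(1))
  also have "\<dots> = (\<Sum>k<dim_row C. \<Sum>l<dim_row D.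
      (A $$ (i div ?r, k) * B $$ (i mod ?r, l)) * (C $$ (k, j div ?s) * D $$ (l, j mod ?s)))"
    unfolding sum_lessThan_mult
    using ij assms by (intro sum.cong refl) (auto simp: index_kron mult_add_less)
  also have "\<dots> = (\<Sum>k<dim_row C. A $$ (i div ?r, k) * C $$ (k, j div ?s))
      * (\<Sum>l<dim_row D. B $$ (i mod ?r, l) * D $$ (l, j mod ?s))"
    by (simp add: sum_product mult_ac)
  also have "\<dots> = kron (A * C) (B * D) $$ (i, j)"
    using ij assms lt by (simp add: index_kron mult_mat_index_sum del: index_mult_mat(1))
  finally show "(kron A B * kron C D) $$ (i, j) = kron (A * C) (B * D) $$ (i, j)" .
qed auto

lemma adj_kron [simp]: "adj (kron A B) = kron (adj A) (adj B)"
  by (rule eq_matI) (auto simp: index_kron div_less_factor mod_less_factor)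

lemma kron_add:
  assumes "dim_row A = dim_row B" "dim_col A = dim_col B"
  shows "kron C (A + B) = kron C A + kron C B" "kron (A + B) C = kron A C + kron B C"
  using assms
  by (auto intro!: eq_matI simp: index_kron div_less_factor mod_less_factor distrib_left distrib_right)

lemma kron_one_one [simp]: "kron (1\<^sub>m m) (1\<^sub>m n) = 1\<^sub>m (m * n)"
proof (rule eq_matI)
  fix i j assume "i < dim_row (1\<^sub>m (m * n) :: complex mat)" "j < dim_col (1\<^sub>m (m * n) :: complex mat)"
  moreover have "i = j \<longleftrightarrow> i div n = j div n \<and> i mod n = j mod n"
    by (metis div_mult_mod_eq)
  ultimately show "kron (1\<^sub>m m) (1\<^sub>m n) $$ (i, j) = 1\<^sub>m (m * n) $$ (i, j)"
    by (auto simp: index_kron div_less_factor mod_less_factor)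
qed auto

lemma kron_unit [simp]: "kron (1\<^sub>m (Suc 0)) A = A" "kron A (1\<^sub>m (Suc 0)) = A"
  by (rule eq_matI; auto simp: index_kron)+

text \<open>Both sides read the same three mixed-radix digits of an index. Facts \<open>d\<close>,
  \<open>m\<close> and \<open>mm\<close> say that the digits do not depend on the order in which
  they are split off.\<close>

lemma kron_assoc: "kron (kron A B) C = kron A (kron B C)"
proof (rule eq_matI)
  fix i j
  assume ij: "i < dim_row (kron A (kron B C))" "j < dim_col (kron A (kron B C))"
  have d: "x div n div m = x div (m * n)" for x m n :: nat
    by (metis div_mult2_eq mult.commute)
  have m: "x mod (m * n) div n = x div n mod m" for x m n :: nat
    using mod_mult2_eq[of x n m] by (cases "n = 0") (auto simp: mult.commute)
  have mm: "x mod (m * n) mod n = x mod n" for x m n :: nat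
    by (simp add: mod_mod_cancel)
  show "kron (kron A B) C $$ (i, j) = kron A (kron B C) $$ (i, j)"
    using ij d m mm div_less_factor[of i "dim_row A" "dim_row B * dim_row C"]
      div_less_factor[of j "dim_col A" "dim_col B * dim_col C"]
      mod_less_factor[of i "dim_row A" "dim_row B * dim_row C"]
      mod_less_factor[of j "dim_col A" "dim_col B * dim_col C"]
      div_less_factor[of i "dim_row A * dim_row B" "dim_row C"]
      div_less_factor[of j "dim_col A * dim_col B" "dim_col C"]
    by (simp add: index_kron mult.assoc)
qed auto

section \<open>Partial traces\<close>

text \<open>The partial trace inside \<open>red\<close>, with the dimensions of the left, middle and
  right block as parameters: a block may then consist of several entries of a level.\<close>

definition ptr :: "nat \<Rightarrow> nat \<Rightarrow> nat \<Rightarrow> complex mat \<Rightarrow> complex mat" where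
  "ptr a b c \<rho> =
    mat b b (\<lambda>(y, x). \<Sum>u<a. \<Sum>w<c. \<rho> $$ ((u * b + y) * c + w, (u * b + x) * c + w))"

text \<open>The dual of \<open>ptr\<close> in the trace pairing, see \<open>mtrace_emb\<close>: it
  carries an observable of the middle block to the whole space.\<close>

definition emb :: "nat \<Rightarrow> nat \<Rightarrow> complex mat \<Rightarrow> complex mat" where
  "emb a c M = kron (kron (1\<^sub>m a) M) (1\<^sub>m c)"

lemma dim_ptr [simp]: "dim_row (ptr a b c \<rho>) = b" "dim_col (ptr a b c \<rho>) = b"
  by (auto simp: ptr_def)

lemma dim_emb [simp]: "dim_row (emb a c M) = a * dim_row M * c" "dim_col (emb a c M) = a * dim_col M * c"
  by (auto simp: emb_def)

lemma emb_mult: "dim_col M = dim_row N \<Longrightarrow> emb a c M * emb a c N = emb a c (M * N)"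
  by (simp add: emb_def kron_mult mult_mat_one_left)

lemma emb_add: "dim_row M = dim_row N \<Longrightarrow> dim_col M = dim_col N \<Longrightarrow> emb a c (M + N) = emb a c M + emb a c N"
  by (simp add: emb_def kron_add)

lemma adj_emb [simp]: "adj (emb a c M) = emb a c (adj M)"
  by (simp add: emb_def)

lemma emb_one [simp]: "emb a c (1\<^sub>m n) = 1\<^sub>m (a * n * c)"
  by (simp add: emb_def)

text \<open>Used to regard an operator on the last factor of a block as one on a smaller block with
  a larger left neighbour.\<close>

lemma emb_kron_one: "emb a c (kron (1\<^sub>m m) M) = emb (a * m) c M"
  by (simp add: emb_def flip: kron_assoc)

lemma index_emb:
  assumes "u < a" "u' < a" "y < dim_row M" "x < dim_col M" "w < c" "w' < c"
  shows "emb a c M $$ ((u * dim_row M + y) * c + w, (u' * dim_col M + x) * c + w')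
    = (if u = u' \<and> w = w' then M $$ (y, x) else 0)"
  using assms by (simp add: emb_def index_kron mult_add_less)

text \<open>The identities in \<open>emb\<close> force equal outer indices, u = u' and w = w', and
  the sum that remains over them is the one defining \<open>ptr\<close>.\<close>

lemma mtrace_emb:
  assumes M: "dim_row M = b" "dim_col M = b" and \<rho>: "dim_row \<rho> = a * b * c" "dim_col \<rho> = a * b * c"
  shows "mtrace (emb a c M * \<rho>) = mtrace (M * ptr a b c \<rho>)"
proof -
  let ?I = "\<lambda>u y w. (u * b + y) * c + w"
  have "mtrace (emb a c M * \<rho>) = (\<Sum>u<a. \<Sum>y<b. \<Sum>w<c. \<Sum>u'<a. \<Sum>x<b. \<Sum>w'<c.
      emb a c M $$ (?I u y w, ?I u' x w') * \<rho> $$ (?I u' x w', ?I u y w))"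
    using assms by (simp add: mtrace_mult sum_lessThan_mult)
  also have "\<dots> = (\<Sum>u<a. \<Sum>y<b. \<Sum>w<c. \<Sum>u'<a. \<Sum>x<b. \<Sum>w'<c.
      if w' = w then if u' = u then M $$ (y, x) * \<rho> $$ (?I u' x w', ?I u y w) else 0 else 0)"
    using M index_emb[of _ a _ _ M _ _ c] by (intro sum.cong refl) auto
  also have "\<dots> = (\<Sum>u<a. \<Sum>y<b. \<Sum>w<c. \<Sum>u'<a. \<Sum>x<b.
      if u' = u then M $$ (y, x) * \<rho> $$ (?I u' x w, ?I u y w) else 0)"
    by (intro sum.cong refl) simp
  also have "\<dots> = (\<Sum>u<a. \<Sum>y<b. \<Sum>w<c. \<Sum>x<b. \<Sum>u'<a.
      if u' = u then M $$ (y, x) * \<rho> $$ (?I u' x w, ?I u y w) else 0)"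
    by (intro sum.cong refl sum.swap)
  also have "\<dots> = (\<Sum>u<a. \<Sum>y<b. \<Sum>w<c. \<Sum>x<b. M $$ (y, x) * \<rho> $$ (?I u x w, ?I u y w))"
    by (intro sum.cong refl) simp
  also have "\<dots> = (\<Sum>y<b. \<Sum>u<a. \<Sum>x<b. \<Sum>w<c. M $$ (y, x) * \<rho> $$ (?I u x w, ?I u y w))"
    by (subst sum.swap) (intro sum.cong refl sum.swap)
  also have "\<dots> = (\<Sum>y<b. \<Sum>x<b. \<Sum>u<a. \<Sum>w<c. M $$ (y, x) * \<rho> $$ (?I u x w, ?I u y w))"
    by (intro sum.cong refl sum.swap)
  also have "\<dots> = (\<Sum>y<b. \<Sum>x<b. M $$ (y, x) * ptr a b c \<rho> $$ (x, y))"
    by (simp add: ptr_def sum_distrib_left)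
  also have "\<dots> = mtrace (M * ptr a b c \<rho>)"
    using M by (simp add: mtrace_mult)
  finally show ?thesis .
qed

lemma mtrace_ptr:
  assumes "dim_row \<rho> = a * b * c" "dim_col \<rho> = a * b * c"
  shows "mtrace (ptr a b c \<rho>) = mtrace \<rho>"
  using mtrace_emb[of "1\<^sub>m b" b \<rho> a c] assms by (simp add: mult_mat_one_left)

lemma mtrace_unit_mult:
  assumes "i < n" "j < n" "dim_row C = n" "dim_col C = n"
  shows "mtrace (mat n n (\<lambda>(r, s). if r = j \<and> s = i then 1 else 0) * C) = C $$ (i, j)"
proof -
  let ?M = "mat n n (\<lambda>(r, s). if r = j \<and> s = i then 1 else 0 :: complex)"
  have "mtrace (?M * C) = (\<Sum>r<n. \<Sum>s<n. ?M $$ (r, s) * C $$ (s, r))"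
    using assms by (simp add: mtrace_mult)
  also have "\<dots> = (\<Sum>r<n. \<Sum>s<n. if s = i then if r = j then C $$ (s, r) else 0 else 0)"
    by (intro sum.cong refl) auto
  also have "\<dots> = C $$ (i, j)" using assms by simp
  finally show ?thesis .
qed

text \<open>Matrix units as test matrices pick out single entries, so the trace pairing separates
  matrices.\<close>

lemma mat_eq_mtraceI:
  assumes dims: "dim_row A = n" "dim_col A = n" "dim_row B = n" "dim_col B = n"
    and eq: "\<And>M. dim_row M = n \<Longrightarrow> dim_col M = n \<Longrightarrow> mtrace (M * A) = mtrace (M * B)"
  shows "A = B"
proof (rule eq_matI)
  fix i j assume "i < dim_row B" "j < dim_col B"
  then show "A $$ (i, j) = B $$ (i, j)"
    using dims eq[of "mat n n (\<lambda>(r, s). if r = j \<and> s = i then 1 else 0)"]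
    by (simp add: mtrace_unit_mult)
qed (use dims in auto)

text \<open>Paired with a test matrix M, the conjugation moves cyclically onto
  \<open>emb a c M\<close>. There A and C cancel because they are isometries, and the middle factor
  becomes \<open>adj G * M * G\<close>.\<close>

lemma ptr_conjugate:
  assumes A: "dim_row A = a" "dim_col A = a" "adj A * A = 1\<^sub>m a"
    and C: "dim_row C = c" "dim_col C = c" "adj C * C = 1\<^sub>m c"
    and G: "dim_row G = b" "dim_col G = b"
    and \<rho>: "dim_row \<rho> = a * b * c" "dim_col \<rho> = a * b * c"
  shows "ptr a b c (kron (kron A G) C * \<rho> * adj (kron (kron A G) C)) = G * ptr a b c \<rho> * adj G"
proof (rule mat_eq_mtraceI[of _ b])
  fix M :: "complex mat" assume M: "dim_row M = b" "dim_col M = b"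
  let ?K = "kron (kron A G) C"
  have "mtrace (M * ptr a b c (?K * \<rho> * adj ?K)) = mtrace ((emb a c M * (?K * \<rho>)) * adj ?K)"
    using assms M by (simp add: mtrace_emb[symmetric] assoc_mult_mat_dim)
  also have "\<dots> = mtrace (adj ?K * emb a c M * ?K * \<rho>)"
    using assms M by (subst mtrace_comm) (simp_all add: assoc_mult_mat_dim)
  also have "adj ?K * emb a c M * ?K = emb a c (adj G * M * G)"
    using assms M by (simp add: emb_def kron_mult mult_mat_one_right)
  also have "mtrace (emb a c (adj G * M * G) * \<rho>) = mtrace (adj G * (M * G * ptr a b c \<rho>))"
    using assms M by (simp add: mtrace_emb assoc_mult_mat_dim)
  also have "\<dots> = mtrace (M * (G * ptr a b c \<rho> * adj G))"
    using assms M by (subst mtrace_comm) (simp_all add: assoc_mult_mat_dim)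
  finally show "mtrace (M * ptr a b c (?K * \<rho> * adj ?K)) = mtrace (M * (G * ptr a b c \<rho> * adj G))" .
qed (use assms in auto)

section \<open>Density operators\<close>

lemma density_nonneg:
  "density d \<rho> \<Longrightarrow> v \<in> carrier_vec d \<Longrightarrow> 0 \<le> Re (\<Sum>i<d. cnj (v $ i) * (\<rho> *\<^sub>v v) $ i)"
  unfolding density_def by blast

text \<open>Let w be the image of v and N its squared norm. Along the line v + t w the quadratic
  form is 2 t N plus a multiple of t^2 and stays nonnegative, so the linear coefficient N
  vanishes.\<close>

lemma density_kernel:
  assumes dens: "density d \<rho>" and v: "v \<in> carrier_vec d"
    and zero: "Re (\<Sum>i<d. cnj (v $ i) * (\<rho> *\<^sub>v v) $ i) = 0"
  shows "\<rho> *\<^sub>v v = 0\<^sub>v d"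
proof -
  have \<rho>: "\<rho> \<in> carrier_mat d d" and herm: "adj \<rho> = \<rho>"
    using dens by (auto simp: density_def)
  define w where "w = \<rho> *\<^sub>v v"
  have w: "w \<in> carrier_vec d" using \<rho> v by (simp add: w_def)
  define B where "B x y = (\<Sum>i<d. cnj (x $ i) * (\<rho> *\<^sub>v y) $ i)" for x y
  define N where "N = (\<Sum>i<d. (cmod (w $ i))\<^sup>2)"
  have Bwv: "B w v = of_real N"
    unfolding B_def N_def w_def[symmetric] of_real_sum complex_norm_square by (simp add: mult.commute)
  have sym: "B x y = cnj (B y x)" if "x \<in> carrier_vec d" "y \<in> carrier_vec d" for x y
  proof -
    have "cnj (\<rho> $$ (i, j)) = \<rho> $$ (j, i)" if "i < d" "j < d" for i j
      using \<rho> herm that by (metis carrier_matD index_adj)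
    moreover have "B x y = (\<Sum>i<d. \<Sum>j<d. cnj (x $ i) * (\<rho> $$ (i, j) * y $ j))"
      if "y \<in> carrier_vec d" for x y
      using that \<rho> by (auto simp: B_def scalar_prod_def atLeast0LessThan sum_distrib_left)
    ultimately show ?thesis
      using that by (simp, subst sum.swap) (intro sum.cong refl, simp)
  qed
  have Bvw: "B v w = of_real N" using sym[OF v w] Bwv by simp
  have expand: "B (v + of_real t \<cdot>\<^sub>v w) (v + of_real t \<cdot>\<^sub>v w)
      = B v v + of_real t * B v w + of_real t * B w v + of_real (t\<^sup>2) * B w w" for t :: real
  proof -
    have "\<rho> *\<^sub>v (v + of_real t \<cdot>\<^sub>v w) = \<rho> *\<^sub>v v + of_real t \<cdot>\<^sub>v (\<rho> *\<^sub>v w)"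
      using \<rho> v w by (simp add: mult_add_distrib_mat_vec mult_mat_vec)
    then show ?thesis
      unfolding B_def using \<rho> v w
      by (simp add: sum_distrib_left sum.distrib[symmetric]) (intro sum.cong refl, simp add: algebra_simps power2_eq_square)
  qed
  have nonneg: "0 \<le> 2 * t * N + t\<^sup>2 * Re (B w w)" for t
  proof -
    have "0 \<le> Re (B (v + of_real t \<cdot>\<^sub>v w) (v + of_real t \<cdot>\<^sub>v w))"
      unfolding B_def using v w by (intro density_nonneg[OF dens]) auto
    moreover have "Re (B v v) = 0" using zero unfolding B_def by blast
    ultimately show ?thesis unfolding expand by (simp add: Bvw Bwv mult_ac)
  qed
  \<comment> \<open>Prepares a value of t for which the linear term dominates; the added 1 keeps q
    positive even if the form vanishes at w.\<close>
  define q where "q = Re (B w w) + 1"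
  have q: "1 \<le> q" unfolding q_def B_def using density_nonneg[OF dens w] by linarith
  define t where "t = - N / q"
  have tq: "t * q = - N" using q by (simp add: t_def)
  have "0 \<le> q\<^sup>2 * (2 * t * N + t\<^sup>2 * (q - 1))"
    using nonneg[of t] by (simp add: q_def)
  also have "\<dots> = 2 * q * N * (t * q) + (t * q)\<^sup>2 * (q - 1)"
    by (simp add: algebra_simps power2_eq_square)
  also have "\<dots> = - (N\<^sup>2 * (q + 1))"
    unfolding tq by (simp add: algebra_simps power2_eq_square)
  finally have "N\<^sup>2 * (q + 1) \<le> 0" by simp
  then have "N = 0"
    using q by (auto simp: mult_le_0_iff)
  then have "\<forall>i<d. w $ i = 0"
    by (simp add: N_def sum_nonneg_eq_0_iff)
  then show ?thesis using w by (auto simp: w_def[symmetric])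
qed

text \<open>The trace is the sum of the quadratic form over the columns of E. Its terms are
  nonnegative, so each one vanishes and \<open>density_kernel\<close> applies to every
  column.\<close>

lemma density_mult_eq_zero:
  assumes dens: "density d \<rho>" and E: "dim_row E = d" "dim_col E = n"
    and tr: "mtrace (adj E * (\<rho> * E)) = 0"
  shows "\<rho> * E = 0\<^sub>m d n"
proof -
  have \<rho>: "dim_row \<rho> = d" "dim_col \<rho> = d" using dens by (auto simp: density_def)
  define Q where "Q v = (\<Sum>i<d. cnj (v $ i) * (\<rho> *\<^sub>v v) $ i)" for v
  have col: "col E k \<in> carrier_vec d" for k by (rule carrier_vecI) (simp add: E)
  have ent: "(\<rho> * E) $$ (i, k) = (\<rho> *\<^sub>v col E k) $ i" if "i < d" "k < n" for i k
    using that by (simp add: E \<rho>)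
  have "mtrace (adj E * (\<rho> * E)) = (\<Sum>k<n. \<Sum>i<d. adj E $$ (k, i) * (\<rho> * E) $$ (i, k))"
    using E \<rho> by (subst mtrace_mult) auto
  also have "\<dots> = (\<Sum>k<n. Q (col E k))"
    unfolding Q_def using E by (intro sum.cong refl) (simp add: ent del: index_mult_mat(1))
  finally have "(\<Sum>k<n. Q (col E k)) = 0" using tr by simp
  then have "(\<Sum>k<n. Re (Q (col E k))) = 0" by (metis Re_sum zero_complex.sel(1))
  moreover have "0 \<le> Re (Q (col E k))" for k
    unfolding Q_def by (rule density_nonneg[OF dens col])
  ultimately have "\<forall>k<n. Re (Q (col E k)) = 0" by (simp add: sum_nonneg_eq_0_iff)
  then have "\<rho> *\<^sub>v col E k = 0\<^sub>v d" if "k < n" for k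
    using density_kernel[OF dens col] that unfolding Q_def by blast
  then show ?thesis
    using E \<rho> ent by (intro eq_matI) (auto simp del: index_mult_mat(1))
qed

section \<open>Gates\<close>

lemma less_2_iff: "i < 2 \<longleftrightarrow> i = 0 \<or> i = (1::nat)"
  by auto

lemma eq_mat2I:
  assumes "dim_row A = 2" "dim_col A = 2" "dim_row B = 2" "dim_col B = 2"
    and "A $$ (0, 0) = B $$ (0, 0)" "A $$ (0, 1) = B $$ (0, 1)"
    and "A $$ (1, 0) = B $$ (1, 0)" "A $$ (1, 1) = B $$ (1, 1)"
  shows "A = B"
  using assms by (intro eq_matI) (auto simp: less_2_iff)

lemma sum_lessThan_2: "(\<Sum>i<2. f i) = f 0 + f (1::nat)" for f :: "nat \<Rightarrow> 'a::comm_monoid_add"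
  by (simp add: numeral_2_eq_2)

lemma kron_one_left_index:
  assumes "dim_row A = 2" "dim_col A = 2" "i < m * 2" "j < m * 2"
  shows "kron (1\<^sub>m m) A $$ (i, j) = (if i div 2 = j div 2 then A $$ (i mod 2, j mod 2) else 0)"
  using assms by (auto simp: index_kron div_less_factor)

text \<open>The canonical projections |0><0| and |1><1|: what \<open>P0\<close> and
  \<open>P1\<close> on one qubit become in the basis of \<open>T\<close>.\<close>

definition diag_proj :: "bool \<Rightarrow> complex mat" where
  "diag_proj b = mat 2 2 (\<lambda>(i, j). if i = j \<and> odd i = b then 1 else 0)"

definition not_mat :: "complex mat" where
  "not_mat = mat 2 2 (\<lambda>(i, j). if i = j then 0 else 1)"

definition sqrtI_mat :: "complex mat" where
  "sqrtI_mat = mat 2 2 (\<lambda>(i, j). (if i = j then (-1) ^ j else 1) / complex_of_real (sqrt 2))"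

definition sqrtNOT_mat :: "complex mat" where
  "sqrtNOT_mat = mat 2 2 (\<lambda>(i, j). if i = j then (1 - \<i>) / 2 else (1 + \<i>) / 2)"

lemmas mat2_defs = diag_proj_def not_mat_def sqrtI_mat_def sqrtNOT_mat_def

lemma dim_mat2 [simp]:
  "dim_row (diag_proj b) = 2" "dim_col (diag_proj b) = 2"
  "dim_row not_mat = 2" "dim_col not_mat = 2"
  "dim_row sqrtI_mat = 2" "dim_col sqrtI_mat = 2"
  "dim_row sqrtNOT_mat = 2" "dim_col sqrtNOT_mat = 2"
  by (auto simp: mat2_defs)

lemma csqrt2: "complex_of_real (sqrt 2) * complex_of_real (sqrt 2) = 2"
  by (simp flip: of_real_mult)

lemma isometry_mat2:
  "adj not_mat * not_mat = 1\<^sub>m 2"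
  "adj sqrtI_mat * sqrtI_mat = 1\<^sub>m 2"
  "adj sqrtNOT_mat * sqrtNOT_mat = 1\<^sub>m 2"
  by (rule eq_mat2I;
      simp add: mult_mat_index_sum sum_lessThan_2 mat2_defs csqrt2 field_simps del: index_mult_mat(1))+

lemma diag_proj_simps [simp]:
  "adj (diag_proj b) = diag_proj b"
  "diag_proj b * diag_proj b = diag_proj b"
  "diag_proj True * diag_proj False = 0\<^sub>m 2 2"
  by (rule eq_mat2I; cases b; simp add: mult_mat_index_sum sum_lessThan_2 mat2_defs del: index_mult_mat(1))+

lemma mod_div_eq_iff: "i = j \<longleftrightarrow> i div 2 = j div 2 \<and> i mod 2 = j mod (2::nat)"
  by (metis div_mult_mod_eq)

lemma kron_diag_proj_index:
  assumes "i < m * 2" "j < m * 2"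
  shows "kron (1\<^sub>m m) (diag_proj b) $$ (i, j) = (if i = j then if odd j = b then 1 else 0 else 0)"
  using assms mod_div_eq_iff[of i j]
  by (auto simp: kron_one_left_index diag_proj_def odd_iff_mod_2_eq_one)

lemma mult_kron_diag_proj:
  assumes "dim_col X = m * 2" "i < dim_row X" "j < m * 2"
  shows "(X * kron (1\<^sub>m m) (diag_proj b)) $$ (i, j) = (if odd j = b then X $$ (i, j) else 0)"
proof -
  have "(X * kron (1\<^sub>m m) (diag_proj b)) $$ (i, j)
      = (\<Sum>k<m * 2. X $$ (i, k) * kron (1\<^sub>m m) (diag_proj b) $$ (k, j))"
    using assms by (subst mult_mat_index_sum) auto
  also have "\<dots> = (\<Sum>k<m * 2. if k = j then if odd j = b then X $$ (i, k) else 0 else 0)"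
    using assms by (intro sum.cong refl) (auto simp: kron_diag_proj_index)
  also have "\<dots> = (if odd j = b then X $$ (i, j) else 0)" using assms by simp
  finally show ?thesis .
qed

lemma kron_diag_proj_mult:
  assumes "dim_row X = m * 2" "i < m * 2" "j < dim_col X"
  shows "(kron (1\<^sub>m m) (diag_proj b) * X) $$ (i, j) = (if odd i = b then X $$ (i, j) else 0)"
proof -
  have "(kron (1\<^sub>m m) (diag_proj b) * X) $$ (i, j)
      = (\<Sum>k<m * 2. kron (1\<^sub>m m) (diag_proj b) $$ (i, k) * X $$ (k, j))"
    using assms by (subst mult_mat_index_sum) auto
  also have "\<dots> = (\<Sum>k<m * 2. if k = i then if odd i = b then X $$ (k, j) else 0 else 0)"
    using assms by (intro sum.cong refl) (auto simp: kron_diag_proj_index)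
  also have "\<dots> = (if odd i = b then X $$ (i, j) else 0)" using assms by simp
  finally show ?thesis .
qed

section \<open>The bit flip and the gates built from it\<close>

lemma even_flip [simp]: "even (flip x) \<longleftrightarrow> odd x"
  by (auto simp: flip_def)

lemma flip_div_2 [simp]: "flip x div 2 = x div 2"
  by (auto simp: flip_def elim!: evenE oddE)

lemma flip_flip [simp]: "flip (flip x) = x"
  by (auto simp: flip_def elim!: evenE oddE)

lemma eq_flip_iff: "y = flip x \<longleftrightarrow> y div 2 = x div 2 \<and> y mod 2 \<noteq> x mod 2"
  by (auto simp: mod_div_eq_iff[of y "flip x"] mod2_eq_if split: if_splits)

lemma flip_div_power: "0 < n \<Longrightarrow> flip x div 2 ^ n = x div 2 ^ n"
  by (cases n) (simp_all add: div_mult2_eq)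

lemma flip_less: "0 < n \<Longrightarrow> flip x < 2 ^ n \<longleftrightarrow> x < 2 ^ n"
  by (metis flip_div_power div_eq_0_iff power_not_zero zero_neq_numeral)

text \<open>Only the last bit is changed, so the gate is an identity tensored with a one-qubit
  matrix. Writing the arity as a successor guarantees that a last bit exists.\<close>

lemma NOT_gate_Suc: "NOT_gate (Suc n) = kron (1\<^sub>m (2 ^ n)) not_mat"
  by (rule eq_matI)
    (auto simp: NOT_gate_def gate_of_def kron_one_left_index eq_flip_iff mat2_defs mult.commute)

lemma sqrtI_gate_Suc: "sqrtI_gate (Suc n) = kron (1\<^sub>m (2 ^ n)) sqrtI_mat"
proof (rule eq_matI)
  fix i j
  assume ij: "i < dim_row (kron (1\<^sub>m (2 ^ n)) sqrtI_mat)" "j < dim_col (kron (1\<^sub>m (2 ^ n)) sqrtI_mat)"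
  then show "sqrtI_gate (Suc n) $$ (i, j) = kron (1\<^sub>m (2 ^ n)) sqrtI_mat $$ (i, j)"
    using mod_div_eq_iff[of i j]
    by (auto simp: sqrtI_gate_def gate_of_def kron_one_left_index eq_flip_iff sqrtI_mat_def)
qed (auto simp: sqrtI_gate_def gate_of_def)

lemma sqrtNOT_gate_Suc: "sqrtNOT_gate (Suc n) = kron (1\<^sub>m (2 ^ n)) sqrtNOT_mat"
proof (rule eq_matI)
  fix i j
  assume ij: "i < dim_row (kron (1\<^sub>m (2 ^ n)) sqrtNOT_mat)" "j < dim_col (kron (1\<^sub>m (2 ^ n)) sqrtNOT_mat)"
  then show "sqrtNOT_gate (Suc n) $$ (i, j) = kron (1\<^sub>m (2 ^ n)) sqrtNOT_mat $$ (i, j)"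
    using mod_div_eq_iff[of i j]
    by (auto simp: sqrtNOT_gate_def gate_of_def kron_one_left_index eq_flip_iff sqrtNOT_mat_def)
qed (auto simp: sqrtNOT_gate_def gate_of_def)

lemma dim_gates [simp]:
  "dim_row (NOT_gate n) = 2 ^ n" "dim_col (NOT_gate n) = 2 ^ n"
  "dim_row (sqrtI_gate n) = 2 ^ n" "dim_col (sqrtI_gate n) = 2 ^ n"
  "dim_row (sqrtNOT_gate n) = 2 ^ n" "dim_col (sqrtNOT_gate n) = 2 ^ n"
  "dim_row (XOR_gate m n) = 2 ^ (m + n)" "dim_col (XOR_gate m n) = 2 ^ (m + n)"
  "dim_row (Toffoli_gate m n p) = 2 ^ (m + n + p)" "dim_col (Toffoli_gate m n p) = 2 ^ (m + n + p)"
  by (auto simp: NOT_gate_def sqrtI_gate_def sqrtNOT_gate_def XOR_gate_def Toffoli_gate_def gate_of_def)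

text \<open>The control P cannot see the flipped bit, so the index map is an involution and the gate
  is a permutation matrix. Both \<open>XOR_gate\<close> and \<open>Toffoli_gate\<close> have this
  form, their control bits lying above bit 0.\<close>

lemma isometry_flip_gate:
  assumes n: "0 < n" and P: "\<And>x. P (flip x) = P x"
  defines "G \<equiv> gate_of n (\<lambda>x y. if y = (if P x then flip x else x) then 1 else 0)"
  shows "adj G * G = 1\<^sub>m (2 ^ n)"
proof (rule eq_matI)
  define f where "f x = (if P x then flip x else x)" for x
  have inv: "f (f x) = x" for x by (simp add: f_def P)
  have lt: "f x < 2 ^ n \<longleftrightarrow> x < 2 ^ n" for x by (simp add: f_def flip_less[OF n])
  fix i j assume "i < dim_row (1\<^sub>m (2 ^ n) :: complex mat)" "j < dim_col (1\<^sub>m (2 ^ n) :: complex mat)"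
  then have ij: "i < 2 ^ n" "j < 2 ^ n" by auto
  have "(adj G * G) $$ (i, j) = (\<Sum>k<2 ^ n. cnj (G $$ (k, i)) * G $$ (k, j))"
    using ij by (simp add: G_def gate_of_def mult_mat_index_sum del: index_mult_mat(1))
  also have "\<dots> = (\<Sum>k<2 ^ n. if k = f i then if k = f j then 1 else 0 else 0)"
    using ij by (intro sum.cong refl) (auto simp: G_def gate_of_def f_def)
  also have "\<dots> = (if f i = f j then 1 else 0)" using ij lt by simp
  also have "f i = f j \<longleftrightarrow> i = j" using inv by metis
  finally show "(adj G * G) $$ (i, j) = 1\<^sub>m (2 ^ n) $$ (i, j)" using ij by simp
qed (auto simp: G_def gate_of_def)

lemma isometry_gates:
  "0 < n \<Longrightarrow> adj (NOT_gate n) * NOT_gate n = 1\<^sub>m (2 ^ n)"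
  "0 < n \<Longrightarrow> adj (sqrtI_gate n) * sqrtI_gate n = 1\<^sub>m (2 ^ n)"
  "0 < n \<Longrightarrow> adj (sqrtNOT_gate n) * sqrtNOT_gate n = 1\<^sub>m (2 ^ n)"
  by (cases n; simp add: NOT_gate_Suc sqrtI_gate_Suc sqrtNOT_gate_Suc kron_mult isometry_mat2
      mult_mat_one_left mult.commute)+

lemma isometry_XOR_gate: "0 < n \<Longrightarrow> adj (XOR_gate m n) * XOR_gate m n = 1\<^sub>m (2 ^ (m + n))"
  unfolding XOR_gate_def by (rule isometry_flip_gate) (auto simp: flip_div_power)

lemma isometry_Toffoli_gate:
  "0 < p \<Longrightarrow> adj (Toffoli_gate m n p) * Toffoli_gate m n p = 1\<^sub>m (2 ^ (m + n + p))"
  unfolding Toffoli_gate_def by (rule isometry_flip_gate) (auto simp: flip_div_power)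

section \<open>Truth perspectives\<close>

locale perspective =
  fixes T :: "complex mat"
  assumes perspective: "truth_perspective T"
begin

lemma dim_T [simp]: "dim_row T = 2" "dim_col T = 2"
  using perspective by (auto simp: truth_perspective_def)

lemma dim_kpow [simp]: "dim_row (kpow T n) = 2 ^ n" "dim_col (kpow T n) = 2 ^ n"
  by (induction n) auto

lemma unitary_T: "adj T * T = 1\<^sub>m 2" "T * adj T = 1\<^sub>m 2"
  using perspective by (auto simp: truth_perspective_def)

lemma unitary_kpow: "adj (kpow T n) * kpow T n = 1\<^sub>m (2 ^ n)" "kpow T n * adj (kpow T n) = 1\<^sub>m (2 ^ n)"
  by (induction n) (auto simp: kron_mult unitary_T mult_mat_one_left mult.commute)

lemma kpow_cancel:
  "dim_row X = 2 ^ n \<Longrightarrow> adj (kpow T n) * (kpow T n * X) = X"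
  by (subst assoc_mult_mat_dim[symmetric]) (auto simp: unitary_kpow mult_mat_one_left)

lemma kpow_1: "kpow T (Suc 0) = T"
  by simp

lemma dim_gateT [simp]: "dim_row (gateT T n G) = 2 ^ n" "dim_col (gateT T n G) = 2 ^ n"
  by (auto simp: gateT_def)

lemma isometry_gateT:
  assumes "dim_row G = 2 ^ n" "dim_col G = 2 ^ n" "adj G * G = 1\<^sub>m (2 ^ n)"
  shows "adj (gateT T n G) * gateT T n G = 1\<^sub>m (2 ^ n)"
proof -
  have "adj (gateT T n G) * gateT T n G = kpow T n * ((adj G * G) * adj (kpow T n))"
    using assms(1,2) by (simp add: gateT_def adj_mult assoc_mult_mat_dim kpow_cancel)
  then show ?thesis using assms by (simp add: mult_mat_one_left unitary_kpow)
qed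

text \<open>Masking the columns of \<open>kpow T (Suc n)\<close> by the parity of their index
  selects those with the given last bit, and the product sums their outer products. This turns the
  entrywise definition into matrix algebra.\<close>

lemma projT_Suc:
  "projT T (Suc n) b = kpow T (Suc n) * kron (1\<^sub>m (2 ^ n)) (diag_proj b) * adj (kpow T (Suc n))"
proof (rule eq_matI)
  let ?K = "kpow T (Suc n)" and ?N = "2 ^ Suc n :: nat"
  let ?E = "kron (1\<^sub>m (2 ^ n)) (diag_proj b)"
  fix r s assume "r < dim_row (?K * ?E * adj ?K)" "s < dim_col (?K * ?E * adj ?K)"
  then have rs: "r < ?N" "s < ?N" by auto
  have KE: "(?K * ?E) $$ (r, k) = (if odd k = b then ?K $$ (r, k) else 0)" if "k < ?N" for k
    using rs that by (subst mult_kron_diag_proj) (auto simp del: kpow.simps)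
  have "(?K * ?E * adj ?K) $$ (r, s)
      = (\<Sum>k<?N. if odd k = b then ?K $$ (r, k) * cnj (?K $$ (s, k)) else 0)"
    using rs by (subst mult_mat_index_sum) (auto simp: KE simp del: kpow.simps index_mult_mat(1) intro!: sum.cong)
  also have "\<dots> = projT T (Suc n) b $$ (r, s)"
    using rs by (auto simp: projT_def sum.If_cases Int_def simp del: kpow.simps intro!: sum.cong)
  finally show "projT T (Suc n) b $$ (r, s) = (?K * ?E * adj ?K) $$ (r, s)" by simp
qed (auto simp: projT_def)

end

lemma At_pos: "0 < At \<phi>"
  by (induction \<phi>) auto

lemma add_mult_mat_dim:
  "dim_row A = dim_row B \<Longrightarrow> dim_col A = dim_row C \<Longrightarrow> dim_col B = dim_row C \<Longrightarrow>
    (A + B) * C = A * C + B * C"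
  by (rule add_mult_distrib_mat[of A "dim_row B" "dim_row C" B C "dim_col C"]) auto

lemma mult_add_mat_dim:
  "dim_col A = dim_row C \<Longrightarrow> dim_row B = dim_row C \<Longrightarrow> dim_col B = dim_col C \<Longrightarrow>
    A * (B + C) = A * B + A * C"
  by (rule mult_add_distrib_mat[of A "dim_row A" "dim_row C" B "dim_col C" C]) auto

section \<open>The Toffoli gate in the Heisenberg picture\<close>

definition off_diagonal :: "complex mat \<Rightarrow> bool" where
  "off_diagonal M \<longleftrightarrow> dim_row M = 2 \<and> dim_col M = 2 \<and> M $$ (0, 0) = 0 \<and> M $$ (1, 1) = 0"

text \<open>Wherever W is nonzero, row and column have the same control bits, so the gate flips the
  last bit of both or of neither, and an off-diagonal M connects only indices of different parity.
  Exactly one of row and column is then odd, so F keeps the entry on exactly one side. The equation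
  is useful because F, transported to the level, annihilates the state.\<close>

lemma Toffoli_conjugate_off_diagonal:
  fixes m n :: nat
  assumes M: "off_diagonal M"
  defines "G \<equiv> Toffoli_gate m n 1"
  defines "W \<equiv> adj G * (kron (1\<^sub>m (2 ^ (m + n))) M * G)"
    and "F \<equiv> kron (1\<^sub>m (2 ^ (m + n))) (diag_proj True)"
  shows "W = F * W + W * F"
proof (rule eq_matI)
  let ?N = "2 ^ (m + n) * 2 :: nat" and ?Z = "kron (1\<^sub>m (2 ^ (m + n))) M"
  \<comment> \<open>The index permutation of the gate: with p = 1 the controls are bits n + 1 and
    1.\<close>
  define f where "f x = (if odd (x div 2 ^ (n + 1)) \<and> odd (x div 2) then flip x else x)" for x :: nat
  have dimM: "dim_row M = 2" "dim_col M = 2" using M by (auto simp: off_diagonal_def)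
  have dims: "dim_row W = ?N" "dim_col W = ?N" "dim_row F = ?N" "dim_col F = ?N"
    "dim_row G = ?N" "dim_col G = ?N"
    by (auto simp: W_def F_def G_def mult.commute)
  have G: "G $$ (y, x) = (if y = f x then 1 else 0)" if "y < ?N" "x < ?N" for x y
    using that by (simp add: G_def Toffoli_gate_def gate_of_def f_def mult.commute)
  have flt: "f x < ?N" if "x < ?N" for x
    using flip_less[of "Suc (m + n)" x] that by (simp add: f_def mult.commute)
  have fdiv: "f x div 2 = x div 2" for x by (simp add: f_def)
  fix i j assume "i < dim_row (F * W + W * F)" "j < dim_col (F * W + W * F)"
  then have ij: "i < ?N" "j < ?N" using dims by auto
  have ZG: "(?Z * G) $$ (k, j) = ?Z $$ (k, f j)" if "k < ?N" for k
  proof -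
    have "(?Z * G) $$ (k, j) = (\<Sum>l<?N. ?Z $$ (k, l) * G $$ (l, j))"
      using that ij dims dimM by (subst mult_mat_index_sum) auto
    also have "\<dots> = (\<Sum>l<?N. if l = f j then ?Z $$ (k, l) else 0)"
      using ij by (intro sum.cong refl) (auto simp: G)
    finally show ?thesis using flt ij by simp
  qed
  have "W $$ (i, j) = (\<Sum>k<?N. cnj (G $$ (k, i)) * (?Z * G) $$ (k, j))"
    unfolding W_def using ij dims dimM
    by (subst mult_mat_index_sum) (auto simp del: index_mult_mat(1))
  also have "\<dots> = (\<Sum>k<?N. if k = f i then ?Z $$ (k, f j) else 0)"
    using ij by (intro sum.cong refl) (auto simp: G ZG simp del: index_mult_mat(1))
  also have "\<dots> = ?Z $$ (f i, f j)" using flt ij by simp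
  also have "\<dots> = (if i div 2 = j div 2 then M $$ (f i mod 2, f j mod 2) else 0)"
    using dimM ij flt by (simp add: kron_one_left_index fdiv)
  finally have W: "W $$ (i, j) = (if i div 2 = j div 2 then M $$ (f i mod 2, f j mod 2) else 0)" .
  \<comment> \<open>Equal parity within a block forces i = j, and then a diagonal entry of M is
    read.\<close>
  have "W $$ (i, j) = 0" if "odd i = odd j"
  proof (cases "i div 2 = j div 2")
    case True
    then have "i = j" using that mod_div_eq_iff[of i j] by (auto simp: odd_iff_mod_2_eq_one)
    moreover have "M $$ (x mod 2, x mod 2) = 0" for x :: nat
      using M by (cases "even x") (auto simp: off_diagonal_def odd_iff_mod_2_eq_one)
    ultimately show ?thesis unfolding W by metis
  qed (simp add: W)
  moreover have "(F * W + W * F) $$ (i, j)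
      = (if odd i then W $$ (i, j) else 0) + (if odd j then W $$ (i, j) else 0)"
    using ij dims by (simp add: F_def kron_diag_proj_mult mult_kron_diag_proj del: index_mult_mat(1))
  ultimately show "W $$ (i, j) = (F * W + W * F) $$ (i, j)" by auto
qed (auto simp: W_def F_def G_def mult.commute)

section \<open>Reduction to the last qubit in the basis of \<open>T\<close>\<close>

context perspective
begin

lemma dim_projT [simp]: "dim_row (projT T n b) = 2 ^ n" "dim_col (projT T n b) = 2 ^ n"
  by (auto simp: projT_def)

lemma projT_1: "projT T (Suc 0) b = T * diag_proj b * adj T"
  using projT_Suc[of 0 b] by (simp add: kpow_1)

lemma cancel_T: "dim_row X = 2 \<Longrightarrow> adj T * (T * X) = X"
  using kpow_cancel[of X 1] by (simp add: kpow_1)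

lemma adj_projT_1 [simp]: "adj (projT T (Suc 0) b) = projT T (Suc 0) b"
  by (simp add: projT_1 adj_mult assoc_mult_mat_dim)

lemma projT_1_mult:
  "projT T (Suc 0) b * projT T (Suc 0) c = T * (diag_proj b * diag_proj c) * adj T"
  by (simp add: projT_1 assoc_mult_mat_dim cancel_T)

definition local_state :: "nat \<Rightarrow> complex mat \<Rightarrow> complex mat" where
  "local_state n R = ptr (2 ^ (n - 1)) 2 1 (adj (kpow T n) * R * kpow T n)"

lemma dim_local_state [simp]: "dim_row (local_state n R) = 2" "dim_col (local_state n R) = 2"
  by (auto simp: local_state_def)

lemma mtrace_mult_local_state:
  assumes "0 < n" "dim_row R = 2 ^ n" "dim_col R = 2 ^ n" "dim_row M = 2" "dim_col M = 2"
  shows "mtrace (M * local_state n R)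
    = mtrace (kron (1\<^sub>m (2 ^ (n - 1))) M * (adj (kpow T n) * R * kpow T n))"
proof -
  have "2 ^ (n - 1) * 2 = (2::nat) ^ n" using assms(1) by (cases n) auto
  then show ?thesis
    using assms mtrace_emb[of M 2 "adj (kpow T n) * R * kpow T n" "2 ^ (n - 1)" 1]
    by (simp add: local_state_def emb_def)
qed

lemma mtrace_local_state:
  assumes "0 < n" "dim_row R = 2 ^ n" "dim_col R = 2 ^ n"
  shows "mtrace (local_state n R) = mtrace R"
proof -
  have two: "2 ^ (n - 1) * 2 = (2::nat) ^ n" using assms(1) by (cases n) auto
  have "mtrace (local_state n R) = mtrace (adj (kpow T n) * (R * kpow T n))"
    using assms two by (simp add: local_state_def mtrace_ptr assoc_mult_mat_dim)
  also have "\<dots> = mtrace (R * (kpow T n * adj (kpow T n)))"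
    using assms by (subst mtrace_comm) (auto simp: assoc_mult_mat_dim)
  finally show ?thesis using assms by (simp add: unitary_kpow mult_mat_one_right)
qed

text \<open>Rotating to the basis of \<open>T\<close> cancels the powers of \<open>T\<close> in
  \<open>gateT\<close>; what remains acts on the last qubit alone.\<close>

lemma local_state_gateT:
  assumes "dim_row R = 2 ^ Suc n" "dim_col R = 2 ^ Suc n" "dim_row g = 2" "dim_col g = 2"
    and "G = gateT T (Suc n) (kron (1\<^sub>m (2 ^ n)) g)"
  shows "local_state (Suc n) (G * R * adj G) = g * local_state (Suc n) R * adj g"
proof -
  \<comment> \<open>The trivial third factor brings the gate into the form required by
    \<open>ptr_conjugate\<close>.\<close>
  let ?K = "kpow T (Suc n)" and ?g = "kron (kron (1\<^sub>m (2 ^ n)) g) (1\<^sub>m 1)"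
  have "adj ?K * (G * R * adj G) * ?K = ?g * (adj ?K * R * ?K) * adj ?g"
    using assms by (simp add: gateT_def adj_mult assoc_mult_mat_dim kpow_cancel
        unitary_kpow mult_mat_one_right mult.commute del: kpow.simps)
  then have "local_state (Suc n) (G * R * adj G) = ptr (2 ^ n) 2 1 (?g * (adj ?K * R * ?K) * adj ?g)"
    by (simp only: local_state_def diff_Suc_1)
  also have "\<dots> = g * ptr (2 ^ n) 2 1 (adj ?K * R * ?K) * adj g"
    using assms by (intro ptr_conjugate) (auto simp: mult_mat_one_left)
  finally show ?thesis by (simp only: local_state_def diff_Suc_1)
qed

lemma probT_local_state:
  assumes "0 < n" "dim_row R = 2 ^ n" "dim_col R = 2 ^ n"
  shows "probT T n R = Re (local_state n R $$ (1, 1))"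
proof -
  obtain k where n: "n = Suc k" using assms(1) by (cases n) auto
  let ?E = "kron (1\<^sub>m (2 ^ k)) (diag_proj True)"
  have unit: "diag_proj True = mat 2 2 (\<lambda>(r, s). if r = 1 \<and> s = 1 then 1 else 0)"
    by (rule eq_mat2I) (auto simp: diag_proj_def)
  have "mtrace (P1 T n * R) = mtrace (kpow T n * (?E * adj (kpow T n) * R))"
    using assms by (simp add: P1_def n projT_Suc assoc_mult_mat_dim mult.commute del: kpow.simps)
  also have "\<dots> = mtrace (?E * (adj (kpow T n) * R * kpow T n))"
    using assms n by (subst mtrace_comm) (auto simp: assoc_mult_mat_dim mult.commute simp del: kpow.simps)
  also have "\<dots> = mtrace (diag_proj True * local_state n R)"
    using assms n by (simp add: mtrace_mult_local_state del: kpow.simps)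
  also have "\<dots> = local_state n R $$ (1, 1)"
    unfolding unit by (rule mtrace_unit_mult) auto
  finally show ?thesis by (simp add: probT_def)
qed

lemma local_state_projT: "local_state (Suc 0) (projT T (Suc 0) b) = diag_proj b"
proof -
  have "adj T * projT T (Suc 0) b * T = diag_proj b"
    by (simp add: projT_1 assoc_mult_mat_dim cancel_T unitary_T mult_mat_one_right)
  then show ?thesis
    by (intro eq_mat2I) (auto simp: local_state_def kpow_1 ptr_def diag_proj_def)
qed

text \<open>The third qubit of the Toffoli gate being in the pure state \<open>P0\<close>, the state is supported
  on \<open>z = 0\<close>. For fixed other qubits the gate maps \<open>z = 0\<close> to a basis vector, so
  no coherence of the last qubit can arise.\<close>

lemma local_state_Toffoli_off_diagonal:
  assumes dens: "density (A * 2 ^ (m + n + 1) * C) \<rho>"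
    and reduced: "ptr (A * 2 ^ (m + n)) 2 C \<rho> = P0 T 1"
    and G: "G = gateT T (m + n + 1) (Toffoli_gate m n 1)"
    and R: "R = G * ptr A (2 ^ (m + n + 1)) C \<rho> * adj G"
    and ij: "i < 2" "j < 2" "i \<noteq> j"
  shows "local_state (m + n + 1) R $$ (i, j) = 0"
proof -
  let ?N = "2 ^ (m + n) * 2 :: nat"
  define K where "K = kpow T (m + n + 1)"
  define \<tau> where "\<tau> = Toffoli_gate m n 1"
  \<comment> \<open>The matrix unit whose trace pairing reads off entry (i, j); it is off-diagonal
    since i and j differ.\<close>
  define M where "M = mat 2 2 (\<lambda>(r, s). if r = j \<and> s = i then 1 else 0 :: complex)"
  define Z where "Z = kron (1\<^sub>m (2 ^ (m + n))) M"
  define F where "F = kron (1\<^sub>m (2 ^ (m + n))) (diag_proj True)"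
  define W where "W = adj \<tau> * (Z * \<tau>)"
  \<comment> \<open>The event that the third argument is true, as a projection on the whole level;
    its left neighbour includes the other two arguments of the gate.\<close>
  define E where "E = emb (A * 2 ^ (m + n)) C (projT T 1 True)"
  define Y where "Y = emb A C (K * W * adj K)"
  define R0 where "R0 = ptr A (2 ^ (m + n + 1)) C \<rho>"
  have dims [simp]: "dim_row K = ?N" "dim_col K = ?N" "dim_row \<tau> = ?N" "dim_col \<tau> = ?N"
    "dim_row Z = ?N" "dim_col Z = ?N" "dim_row F = ?N" "dim_col F = ?N"
    "dim_row W = ?N" "dim_col W = ?N" "dim_row M = 2" "dim_col M = 2"
    "dim_row R0 = ?N" "dim_col R0 = ?N"
    by (auto simp: K_def \<tau>_def M_def Z_def F_def W_def R0_def simp del: kpow.simps)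
  have \<rho> [simp]: "dim_row \<rho> = A * ?N * C" "dim_col \<rho> = A * ?N * C" and herm: "adj \<rho> = \<rho>"
    using dens by (auto simp: density_def mult_ac)
  have [simp]: "dim_row E = A * ?N * C" "dim_col E = A * ?N * C"
    "dim_row Y = A * ?N * C" "dim_col Y = A * ?N * C"
    by (auto simp: E_def Y_def)
  have E: "adj E = E" "E * E = E"
    by (simp_all add: E_def emb_mult projT_1_mult) (simp add: projT_1)
  \<comment> \<open>The reduced state \<open>P0 T 1\<close> is orthogonal to the projection for the
    value 1.\<close>
  have "mtrace (E * \<rho>) = mtrace (projT T 1 True * P0 T 1)"
    unfolding E_def reduced[symmetric] by (rule mtrace_emb) auto
  also have "\<dots> = 0"
    by (simp add: P0_def projT_1_mult)
  finally have "mtrace (E * \<rho>) = 0" .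
  moreover have "mtrace (E * (\<rho> * E)) = mtrace (E * \<rho>)"
    by (subst mtrace_comm) (simp_all add: assoc_mult_mat_dim E(2), subst mtrace_comm, simp_all)
  \<comment> \<open>Here positivity passes from a vanishing trace to a vanishing product.\<close>
  ultimately have \<rho>E: "\<rho> * E = 0\<^sub>m (A * ?N * C) (A * ?N * C)"
    using density_mult_eq_zero[OF dens, of E "A * ?N * C"] E(1) by (simp add: mult_ac)
  have "E * \<rho> = adj (\<rho> * E)" by (simp add: adj_mult E(1) herm)
  also have "\<dots> = 0\<^sub>m (A * ?N * C) (A * ?N * C)"
    unfolding \<rho>E by (rule eq_matI) auto
  finally have E\<rho>: "E * \<rho> = 0\<^sub>m (A * ?N * C) (A * ?N * C)" .
  have "off_diagonal M" using ij by (auto simp: off_diagonal_def M_def)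
  then have WF: "W = F * W + W * F"
    unfolding W_def F_def Z_def \<tau>_def by (rule Toffoli_conjugate_off_diagonal)
  have KFK: "K * F * adj K = kron (1\<^sub>m (2 ^ (m + n))) (projT T 1 True)"
    unfolding K_def F_def
    by (simp add: kron_mult mult_mat_one_right unitary_kpow projT_1)
  have cK: "adj K * (K * X) = X" if "dim_row X = ?N" for X
    using kpow_cancel[of X "m + n + 1"] that by (simp add: K_def del: kpow.simps)
  have "K * W * adj K = (K * F * adj K) * (K * W * adj K) + (K * W * adj K) * (K * F * adj K)"
  proof -
    have "K * W * adj K = K * (F * W + W * F) * adj K" using WF by simp
    also have "\<dots> = K * (F * W) * adj K + K * (W * F) * adj K"
      by (simp add: mult_add_mat_dim add_mult_mat_dim)
    also have "K * (F * W) * adj K = (K * F * adj K) * (K * W * adj K)"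
      by (simp add: assoc_mult_mat_dim cK)
    also have "K * (W * F) * adj K = (K * W * adj K) * (K * F * adj K)"
      by (simp add: assoc_mult_mat_dim cK)
    finally show ?thesis .
  qed
  \<comment> \<open>The relation \<open>WF\<close> is transported by the unitary K and by
    \<open>emb\<close>, F becoming the projection E.\<close>
  then have YE: "Y = E * Y + Y * E"
    unfolding Y_def E_def emb_kron_one[symmetric] KFK[symmetric]
    by (simp add: emb_mult flip: emb_add)
  have "local_state (m + n + 1) R $$ (i, j) = mtrace (M * local_state (m + n + 1) R)"
    unfolding M_def by (rule mtrace_unit_mult[symmetric]) (use ij in auto)
  also have "\<dots> = mtrace (Z * (adj K * R * K))"
    by (subst mtrace_mult_local_state) (auto simp: R G Z_def K_def simp del: kpow.simps)
  also have "adj K * R * K = \<tau> * (adj K * R0 * K * adj \<tau>)"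
  proof -
    have "G = K * \<tau> * adj K" by (simp add: G gateT_def K_def \<tau>_def)
    moreover have "R = G * R0 * adj G" by (simp only: R R0_def)
    ultimately show ?thesis
      by (simp add: adj_mult assoc_mult_mat_dim cK)
        (simp add: K_def unitary_kpow mult_mat_one_right del: kpow.simps)
  qed
  also have "mtrace (Z * (\<tau> * (adj K * R0 * K * adj \<tau>))) = mtrace ((Z * \<tau> * (adj K * R0 * K)) * adj \<tau>)"
    by (simp add: assoc_mult_mat_dim)
  also have "\<dots> = mtrace ((W * adj K * R0) * K)"
    by (subst mtrace_comm) (simp_all add: assoc_mult_mat_dim W_def)
  also have "\<dots> = mtrace (K * W * adj K * R0)"
    by (subst mtrace_comm) (simp_all add: assoc_mult_mat_dim)
  also have "\<dots> = mtrace (Y * \<rho>)"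
    unfolding Y_def R0_def by (rule mtrace_emb[symmetric]) (simp_all add: mult.commute)
  \<comment> \<open>In each summand E can be brought next to the state, in the first one by a cyclic
    shift, so both vanish.\<close>
  also have "\<dots> = mtrace (E * (Y * \<rho>)) + mtrace (Y * (E * \<rho>))"
    by (subst YE) (simp add: add_mult_mat_dim mtrace_add assoc_mult_mat_dim)
  also have "mtrace (E * (Y * \<rho>)) = mtrace (Y * (\<rho> * E))"
    by (subst mtrace_comm) (simp_all add: assoc_mult_mat_dim)
  finally show ?thesis by (simp add: \<rho>E E\<rho>)
qed

end

section \<open>Conjugation by one-qubit gates, entry by entry\<close>

lemma diag_proj_index:
  "diag_proj b $$ (0, 0) = of_bool (\<not> b)" "diag_proj b $$ (0, 1) = 0"
  "diag_proj b $$ (1, 0) = 0" "diag_proj b $$ (1, 1) = of_bool b"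
  by (simp_all add: diag_proj_def)

lemma conjugate_mat2_index:
  assumes "dim_row g = 2" "dim_col g = 2" "dim_row X = 2" "dim_col X = 2" "i < 2" "j < 2"
  shows "(g * X * adj g) $$ (i, j)
    = (g $$ (i, 0) * X $$ (0, 0) + g $$ (i, 1) * X $$ (1, 0)) * cnj (g $$ (j, 0))
    + (g $$ (i, 0) * X $$ (0, 1) + g $$ (i, 1) * X $$ (1, 1)) * cnj (g $$ (j, 1))"
  using assms by (simp add: mult_mat_index_sum sum_lessThan_2 del: index_mult_mat(1))

context
  fixes X :: "complex mat"
  assumes X: "dim_row X = 2" "dim_col X = 2"
begin

lemma conjugate_not_mat:
  "(not_mat * X * adj not_mat) $$ (0, 0) = X $$ (1, 1)"
  "(not_mat * X * adj not_mat) $$ (0, 1) = X $$ (1, 0)"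
  "(not_mat * X * adj not_mat) $$ (1, 0) = X $$ (0, 1)"
  "(not_mat * X * adj not_mat) $$ (1, 1) = X $$ (0, 0)"
  using X by (simp_all add: conjugate_mat2_index not_mat_def del: index_mult_mat(1))

text \<open>In entry (1, 1) the off-diagonal part of X enters only through the sum of its two
  entries; in \<open>conjugate_sqrtNOT_mat\<close> it enters only through their difference. For a
  diagonal X both give half the trace.\<close>

lemma conjugate_sqrtI_mat:
  "(sqrtI_mat * X * adj sqrtI_mat) $$ (0, 0) = (X $$ (0, 0) + X $$ (0, 1) + X $$ (1, 0) + X $$ (1, 1)) / 2"
  "(sqrtI_mat * X * adj sqrtI_mat) $$ (0, 1) = (X $$ (0, 0) - X $$ (0, 1) + X $$ (1, 0) - X $$ (1, 1)) / 2"
  "(sqrtI_mat * X * adj sqrtI_mat) $$ (1, 0) = (X $$ (0, 0) + X $$ (0, 1) - X $$ (1, 0) - X $$ (1, 1)) / 2"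
  "(sqrtI_mat * X * adj sqrtI_mat) $$ (1, 1) = (X $$ (0, 0) - X $$ (0, 1) - X $$ (1, 0) + X $$ (1, 1)) / 2"
  using X by (simp_all add: conjugate_mat2_index sqrtI_mat_def csqrt2 add_divide_distrib
      diff_divide_distrib distrib_right left_diff_distrib del: index_mult_mat(1))

lemma conjugate_sqrtNOT_mat:
  "(sqrtNOT_mat * X * adj sqrtNOT_mat) $$ (0, 0)
    = (X $$ (0, 0) - \<i> * X $$ (0, 1) + \<i> * X $$ (1, 0) + X $$ (1, 1)) / 2"
  "(sqrtNOT_mat * X * adj sqrtNOT_mat) $$ (0, 1)
    = (X $$ (0, 1) - \<i> * X $$ (0, 0) + X $$ (1, 0) + \<i> * X $$ (1, 1)) / 2"
  "(sqrtNOT_mat * X * adj sqrtNOT_mat) $$ (1, 0)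
    = (X $$ (0, 1) + \<i> * X $$ (0, 0) + X $$ (1, 0) - \<i> * X $$ (1, 1)) / 2"
  "(sqrtNOT_mat * X * adj sqrtNOT_mat) $$ (1, 1)
    = (X $$ (0, 0) + \<i> * X $$ (0, 1) - \<i> * X $$ (1, 0) + X $$ (1, 1)) / 2"
  using X by (simp_all add: conjugate_mat2_index sqrtNOT_mat_def complex_eq_iff field_simps
      del: index_mult_mat(1))

end

section \<open>Syntactical trees\<close>

abbreviation Ats :: "form list \<Rightarrow> nat" where
  "Ats xs \<equiv> sum_list (map At xs)"

text \<open>Expansion conserves atoms, so every level lives on the same space.\<close>

lemma Ats_concat_expand [simp]: "Ats (concat (map expand xs)) = Ats xs"
proof -
  have "Ats (expand \<phi>) = At \<phi>" for \<phi> by (cases \<phi>) auto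
  then show ?thesis by (induction xs) auto
qed

lemma level_1 [simp]: "level \<gamma> (Suc 0) = [\<gamma>]"
  by (simp add: level_def)

lemma level_Suc: "1 \<le> i \<Longrightarrow> level \<gamma> (Suc i) = concat (map expand (level \<gamma> i))"
  by (cases i) (auto simp: level_def)

lemma Ats_level: "1 \<le> i \<Longrightarrow> Ats (level \<gamma> i) = At \<gamma>"
  by (induction i rule: dec_induct) (auto simp: level_Suc)

lemma height_pos: "1 \<le> height \<phi>"
  by (induction \<phi>) auto

text \<open>A step down the tree loses a unit of height or leaves an atom in place. Hence, in
  \<open>height_gt_level\<close>, a nonatomic entry never stands in the last level.\<close>

lemma height_level:
  "1 \<le> i \<Longrightarrow> i \<le> height \<gamma> \<Longrightarrow> \<phi> \<in> set (level \<gamma> i) \<Longrightarrow> height \<phi> + i \<le> Suc (height \<gamma>)"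
proof (induction i arbitrary: \<phi> rule: dec_induct)
  case base
  then show ?case by simp
next
  case (step i)
  then obtain \<psi> where \<psi>: "\<psi> \<in> set (level \<gamma> i)" "\<phi> \<in> set (expand \<psi>)"
    by (auto simp: level_Suc)
  then have "height \<psi> + i \<le> Suc (height \<gamma>)" using step by simp
  then show ?case using \<psi>(2) step.prems(1) by (cases \<psi>) auto
qed

lemma height_gt_level:
  assumes "1 \<le> i" "i \<le> height \<gamma>" "\<phi> \<in> set (level \<gamma> i)" "\<not> is_atomic \<phi>"
  shows "Suc i \<le> height \<gamma>"
proof -
  have "Suc 0 \<le> height \<psi>" for \<psi> using height_pos by simp
  then have "2 \<le> height \<phi>" using assms(4) by (cases \<phi>) (auto simp: max_def)
  then show ?thesis using height_level[OF assms(1-3)] by simp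
qed

text \<open>The children of an entry occupy exactly its tensor factor: the neighbours expand
  independently and keep their atom counts.\<close>

lemma level_split_Suc:
  assumes "1 \<le> i" "level \<gamma> i = xs @ \<phi> # ys"
  shows "\<exists>xs' ys'. level \<gamma> (Suc i) = xs' @ expand \<phi> @ ys' \<and> Ats xs' = Ats xs \<and> Ats ys' = Ats ys"
  using assms
  by (intro exI[of _ "concat (map expand xs)"] exI[of _ "concat (map expand ys)"])
    (simp add: level_Suc del: map_concat)

lemma subforms_self [simp]: "\<phi> \<in> subforms \<phi>"
  by (cases \<phi>) auto

lemma expand_subforms: "\<phi> \<in> subforms \<gamma> \<Longrightarrow> set (expand \<phi>) \<subseteq> subforms \<gamma>"
  by (induction \<gamma>) auto

lemma subforms_subset [simp]: "subforms \<phi> \<subseteq> subforms \<gamma> \<longleftrightarrow> \<phi> \<in> subforms \<gamma>"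
proof
  show "\<phi> \<in> subforms \<gamma> \<Longrightarrow> subforms \<phi> \<subseteq> subforms \<gamma>" by (induction \<gamma>) auto
qed (use subforms_self in blast)

lemma occurrence:
  assumes "\<phi> \<in> subforms \<gamma>"
  shows "\<exists>i xs ys. 1 \<le> i \<and> i \<le> height \<gamma> \<and> level \<gamma> i = xs @ \<phi> # ys"
proof -
  let ?occ = "\<lambda>\<phi>. \<exists>i. 1 \<le> i \<and> i \<le> height \<gamma> \<and> \<phi> \<in> set (level \<gamma> i)"
  have child: "?occ \<psi>" if "?occ \<phi>" "\<not> is_atomic \<phi>" "\<psi> \<in> set (expand \<phi>)" for \<phi> \<psi>
  proof -
    from that(1) obtain i where i: "1 \<le> i" "i \<le> height \<gamma>" "\<phi> \<in> set (level \<gamma> i)" by blast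
    have "\<psi> \<in> set (level \<gamma> (Suc i))" using i that(3) by (auto simp: level_Suc)
    then show ?thesis using height_gt_level[OF i that(2)] by (intro exI[of _ "Suc i"]) auto
  qed
  \<comment> \<open>Generalised from the root: any formula that occurs brings all its subformulas
    along, by \<open>child\<close>.\<close>
  have "?occ \<psi> \<Longrightarrow> \<phi> \<in> subforms \<psi> \<Longrightarrow> ?occ \<phi>" for \<psi>
  proof (induction \<psi>)
    case (Neg \<psi>)
    then show ?case using child[of "Neg \<psi>" \<psi>] by auto
  next
    case (SqId \<psi>)
    then show ?case using child[of "SqId \<psi>" \<psi>] by auto
  next
    case (SqNeg \<psi>)
    then show ?case using child[of "SqNeg \<psi>" \<psi>] by auto
  next
    case (Xor \<psi> \<chi>)
    then show ?case using child[of "Xor \<psi> \<chi>"] by auto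
  next
    case (Tof \<psi> \<chi> \<omega>)
    then show ?case using child[of "Tof \<psi> \<chi> \<omega>"] by auto
  qed auto
  moreover have "?occ \<gamma>" using height_pos by (intro exI[of _ 1]) auto
  ultimately show ?thesis using assms by (meson split_list)
qed

text \<open>\<open>level_gate\<close> for an arbitrary list, so that a level can be cut around one
  entry.\<close>

definition tensor_gate :: "complex mat \<Rightarrow> form list \<Rightarrow> complex mat" where
  "tensor_gate T xs = foldl kron (1\<^sub>m 1) (map (entry_gate T) xs)"

lemma foldl_kron: "foldl kron A Bs = kron A (foldl kron (1\<^sub>m 1) Bs)"
proof (induction Bs arbitrary: A)
  case (Cons B Bs)
  show ?case using Cons[of "kron A B"] Cons[of B] by (simp add: kron_assoc)
qed simp

lemma tensor_gate_Nil [simp]: "tensor_gate T [] = 1\<^sub>m 1"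
  by (simp add: tensor_gate_def)

lemma tensor_gate_Cons [simp]: "tensor_gate T (\<phi> # xs) = kron (entry_gate T \<phi>) (tensor_gate T xs)"
  using foldl_kron[of "entry_gate T \<phi>"] by (simp add: tensor_gate_def)

lemma tensor_gate_append: "tensor_gate T (xs @ ys) = kron (tensor_gate T xs) (tensor_gate T ys)"
  by (induction xs) (simp_all add: kron_assoc)

context perspective
begin

lemma dim_entry_gate [simp]:
  "dim_row (entry_gate T \<phi>) = 2 ^ At \<phi>" "dim_col (entry_gate T \<phi>) = 2 ^ At \<phi>"
  by (cases \<phi>; simp)+

lemma isometry_entry_gate: "adj (entry_gate T \<phi>) * entry_gate T \<phi> = 1\<^sub>m (2 ^ At \<phi>)"
  by (cases \<phi>) (simp_all add: isometry_gateT isometry_gates isometry_XOR_gate isometry_Toffoli_gate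
      At_pos mult_mat_one_left)

lemma dim_tensor_gate [simp]:
  "dim_row (tensor_gate T xs) = 2 ^ Ats xs" "dim_col (tensor_gate T xs) = 2 ^ Ats xs"
  by (induction xs) (simp_all add: power_add)

lemma isometry_tensor_gate: "adj (tensor_gate T xs) * tensor_gate T xs = 1\<^sub>m (2 ^ Ats xs)"
  by (induction xs) (simp_all add: kron_mult isometry_entry_gate power_add mult_mat_one_left)

lemma level_gate_split:
  "level \<gamma> i = xs @ \<phi> # ys \<Longrightarrow>
    level_gate T \<gamma> i = kron (kron (tensor_gate T xs) (entry_gate T \<phi>)) (tensor_gate T ys)"
  unfolding level_gate_def tensor_gate_def[symmetric] by (simp add: tensor_gate_append kron_assoc)

end

section \<open>Holistic models\<close>

locale holistic_model = perspective +
  fixes Hol :: "form \<Rightarrow> nat \<Rightarrow> complex mat" and \<gamma> :: form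
  assumes holistic: "holistic T Hol"
begin

abbreviation meaning :: "form \<Rightarrow> complex mat" where
  "meaning \<equiv> hol_meaning Hol \<gamma>"

definition state :: "form \<Rightarrow> complex mat" where
  "state \<phi> = local_state (At \<phi>) (meaning \<phi>)"

lemma density_Hol:
  "1 \<le> i \<Longrightarrow> i \<le> height \<gamma> \<Longrightarrow> density (2 ^ At \<gamma>) (Hol \<gamma> i)"
  using holistic by (simp add: holistic_def)

lemma Hol_step:
  "1 \<le> i \<Longrightarrow> Suc i \<le> height \<gamma> \<Longrightarrow>
    Hol \<gamma> i = level_gate T \<gamma> i * Hol \<gamma> (Suc i) * adj (level_gate T \<gamma> i)"
  using holistic unfolding holistic_def by (simp add: Suc_le_eq)

lemma is_pos_split:
  "1 \<le> i \<Longrightarrow> i \<le> height \<gamma> \<Longrightarrow> level \<gamma> i = xs @ \<phi> # ys \<Longrightarrow>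
    is_pos \<gamma> i (length xs) \<and> level \<gamma> i ! length xs = \<phi>"
  by (simp add: is_pos_def)

text \<open>Normality makes the arbitrary choice in \<open>hol_meaning\<close> harmless: the chosen
  occurrence and the given one have the same reduced state.\<close>

lemma meaning_eq_ctx:
  assumes "is_pos \<gamma> i j" "level \<gamma> i ! j = \<phi>"
  shows "meaning \<phi> = ctx Hol \<gamma> i j"
proof -
  have "\<exists>i j. is_pos \<gamma> i j \<and> level \<gamma> i ! j = \<phi> \<and> meaning \<phi> = ctx Hol \<gamma> i j"
    unfolding hol_meaning_def by (rule someI_ex) (use assms in blast)
  then show ?thesis using holistic assms unfolding holistic_def by metis
qed

lemma meaning_split:
  assumes "1 \<le> i" "i \<le> height \<gamma>" "level \<gamma> i = xs @ \<phi> # ys"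
  shows "meaning \<phi> = ptr (2 ^ Ats xs) (2 ^ At \<phi>) (2 ^ Ats ys) (Hol \<gamma> i)"
  using is_pos_split[OF assms] meaning_eq_ctx[of i "length xs" \<phi>] assms(3)
  by (simp add: ctx_def red_def ptr_def Let_def nth_append)

lemma dim_Hol:
  assumes "1 \<le> i" "i \<le> height \<gamma>" "level \<gamma> i = xs @ zs @ ys"
  shows "dim_row (Hol \<gamma> i) = 2 ^ Ats xs * 2 ^ Ats zs * 2 ^ Ats ys"
    "dim_col (Hol \<gamma> i) = 2 ^ Ats xs * 2 ^ Ats zs * 2 ^ Ats ys"
  using density_Hol[OF assms(1,2)] Ats_level[OF assms(1), of \<gamma>] assms(3)
  by (auto simp: density_def power_add[symmetric] add.assoc)

text \<open>The children are kept together as one block, since their joint state need not be a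
  product of their meanings. The gates of the neighbouring entries are isometries and disappear by
  \<open>ptr_conjugate\<close>.\<close>

lemma meaning_step:
  assumes "\<phi> \<in> subforms \<gamma>" "\<not> is_atomic \<phi>"
  shows "\<exists>i xs ys. 1 \<le> i \<and> i \<le> height \<gamma> \<and> level \<gamma> i = xs @ expand \<phi> @ ys \<and>
    meaning \<phi> = entry_gate T \<phi> * ptr (2 ^ Ats xs) (2 ^ At \<phi>) (2 ^ Ats ys) (Hol \<gamma> i)
      * adj (entry_gate T \<phi>)"
proof -
  obtain i xs ys where i: "1 \<le> i" "i \<le> height \<gamma>" and l: "level \<gamma> i = xs @ \<phi> # ys"
    using occurrence[OF assms(1)] by blast
  have Suc: "Suc i \<le> height \<gamma>" by (rule height_gt_level[OF i _ assms(2)]) (simp add: l)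
  obtain xs' ys' where l': "level \<gamma> (Suc i) = xs' @ expand \<phi> @ ys'" "Ats xs' = Ats xs" "Ats ys' = Ats ys"
    using level_split_Suc[OF i(1) l] by blast
  have "Ats (expand \<phi>) = At \<phi>" using Ats_concat_expand[of "[\<phi>]"] by simp
  then have dims: "dim_row (Hol \<gamma> (Suc i)) = 2 ^ Ats xs * 2 ^ At \<phi> * 2 ^ Ats ys"
    "dim_col (Hol \<gamma> (Suc i)) = 2 ^ Ats xs * 2 ^ At \<phi> * 2 ^ Ats ys"
    using dim_Hol[OF _ Suc l'(1)] l' by auto
  have "meaning \<phi> = entry_gate T \<phi> * ptr (2 ^ Ats xs) (2 ^ At \<phi>) (2 ^ Ats ys) (Hol \<gamma> (Suc i))
      * adj (entry_gate T \<phi>)"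
    unfolding meaning_split[OF i l] Hol_step[OF i(1) Suc] level_gate_split[OF l]
    using dims by (intro ptr_conjugate) (auto simp: isometry_tensor_gate)
  then show ?thesis using Suc l' by (intro exI[of _ "Suc i"] exI[of _ xs'] exI[of _ ys']) auto
qed

lemma dim_meaning:
  assumes "\<phi> \<in> subforms \<gamma>"
  shows "dim_row (meaning \<phi>) = 2 ^ At \<phi>" "dim_col (meaning \<phi>) = 2 ^ At \<phi>"
  using occurrence[OF assms] meaning_split by fastforce+

lemma mtrace_state:
  assumes "\<phi> \<in> subforms \<gamma>"
  shows "mtrace (state \<phi>) = 1"
proof -
  obtain i xs ys where i: "1 \<le> i" "i \<le> height \<gamma>" and l: "level \<gamma> i = xs @ \<phi> # ys"
    using occurrence[OF assms] by blast
  have "mtrace (state \<phi>) = mtrace (meaning \<phi>)"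
    unfolding state_def using At_pos dim_meaning[OF assms] by (rule mtrace_local_state)
  also have "\<dots> = mtrace (Hol \<gamma> i)"
    unfolding meaning_split[OF i l] using dim_Hol[OF i, of xs "[\<phi>]" ys] l by (intro mtrace_ptr) auto
  finally show ?thesis using density_Hol[OF i] by (simp add: density_def)
qed

lemma probT_state:
  "\<phi> \<in> subforms \<gamma> \<Longrightarrow> probT T (At \<phi>) (meaning \<phi>) = Re (state \<phi> $$ (1, 1))"
  unfolding state_def by (intro probT_local_state At_pos dim_meaning)

lemma meaning_unary:
  assumes "\<phi> \<in> subforms \<gamma>" "\<not> is_atomic \<phi>" "expand \<phi> = [\<psi>]"
  shows "meaning \<phi> = entry_gate T \<phi> * meaning \<psi> * adj (entry_gate T \<phi>)"
proof -
  obtain i xs ys where i: "1 \<le> i" "i \<le> height \<gamma>" and l: "level \<gamma> i = xs @ expand \<phi> @ ys"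
    and eq: "meaning \<phi> = entry_gate T \<phi> * ptr (2 ^ Ats xs) (2 ^ At \<phi>) (2 ^ Ats ys) (Hol \<gamma> i)
      * adj (entry_gate T \<phi>)"
    using meaning_step[OF assms(1,2)] by blast
  have "At \<psi> = At \<phi>" using Ats_concat_expand[of "[\<phi>]"] assms(3) by simp
  then show ?thesis using meaning_split[OF i, of xs \<psi> ys] l assms(3) eq by simp
qed

lemma state_unary:
  assumes "\<phi> \<in> subforms \<gamma>" "\<not> is_atomic \<phi>" "expand \<phi> = [\<psi>]" "dim_row g = 2" "dim_col g = 2"
    and gate: "\<And>n. At \<psi> = Suc n \<Longrightarrow> entry_gate T \<phi> = gateT T (Suc n) (kron (1\<^sub>m (2 ^ n)) g)"
  shows "state \<phi> = g * state \<psi> * adj g"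
proof -
  obtain n where n: "At \<psi> = Suc n" using At_pos[of \<psi>] by (cases "At \<psi>") auto
  have "At \<phi> = At \<psi>" using Ats_concat_expand[of "[\<phi>]"] assms(3) by simp
  moreover have "\<psi> \<in> subforms \<gamma>" using expand_subforms[OF assms(1)] assms(3) by simp
  then have "dim_row (meaning \<psi>) = 2 ^ Suc n" "dim_col (meaning \<psi>) = 2 ^ Suc n"
    using dim_meaning[of \<psi>] n by auto
  ultimately show ?thesis
    using meaning_unary[OF assms(1-3)] n assms(4,5) gate[OF n]
    by (simp only: state_def local_state_gateT)
qed

lemma state_Neg: "Neg \<phi> \<in> subforms \<gamma> \<Longrightarrow> state (Neg \<phi>) = not_mat * state \<phi> * adj not_mat"
  by (rule state_unary) (auto simp: NOT_gate_Suc)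

lemma state_SqId: "SqId \<phi> \<in> subforms \<gamma> \<Longrightarrow> state (SqId \<phi>) = sqrtI_mat * state \<phi> * adj sqrtI_mat"
  by (rule state_unary) (auto simp: sqrtI_gate_Suc)

lemma state_SqNeg:
  "SqNeg \<phi> \<in> subforms \<gamma> \<Longrightarrow> state (SqNeg \<phi>) = sqrtNOT_mat * state \<phi> * adj sqrtNOT_mat"
  by (rule state_unary) (auto simp: sqrtNOT_gate_Suc)

lemma meaning_FF: "FF \<in> subforms \<gamma> \<Longrightarrow> meaning FF = P0 T 1"
  using occurrence is_pos_split meaning_eq_ctx holistic unfolding holistic_def by metis

lemma meaning_TT: "TT \<in> subforms \<gamma> \<Longrightarrow> meaning TT = P1 T 1"
  using occurrence is_pos_split meaning_eq_ctx holistic unfolding holistic_def by metis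

lemma state_FF: "FF \<in> subforms \<gamma> \<Longrightarrow> state FF = diag_proj False"
  by (simp add: state_def meaning_FF P0_def local_state_projT)

lemma state_TT: "TT \<in> subforms \<gamma> \<Longrightarrow> state TT = diag_proj True"
  by (simp add: state_def meaning_TT P1_def local_state_projT)

lemma state_conj_off_diagonal:
  assumes "conj \<phi> \<psi> \<in> subforms \<gamma>" "i < 2" "j < 2" "i \<noteq> j"
  shows "state (conj \<phi> \<psi>) $$ (i, j) = 0"
proof -
  let ?\<chi> = "Tof \<phi> \<psi> FF"
  have sub: "?\<chi> \<in> subforms \<gamma>" using assms(1) by (simp add: conj_def)
  obtain k xs ys where k: "1 \<le> k" "k \<le> height \<gamma>" and l: "level \<gamma> k = xs @ expand ?\<chi> @ ys"
    and eq: "meaning ?\<chi> = entry_gate T ?\<chi> * ptr (2 ^ Ats xs) (2 ^ At ?\<chi>) (2 ^ Ats ys) (Hol \<gamma> k)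
      * adj (entry_gate T ?\<chi>)"
    using meaning_step[OF sub] by auto
  have "FF \<in> subforms \<gamma>" using expand_subforms[OF sub] by simp
  \<comment> \<open>\<open>FF\<close> is the third child: the block to its left consists of
    \<open>xs\<close> and the two other arguments.\<close>
  then have reduced: "ptr (2 ^ Ats xs * 2 ^ (At \<phi> + At \<psi>)) 2 (2 ^ Ats ys) (Hol \<gamma> k) = P0 T 1"
    using meaning_split[OF k, of "xs @ [\<phi>, \<psi>]" FF ys] l by (simp add: meaning_FF power_add mult_ac)
  have dens: "density (2 ^ Ats xs * 2 ^ (At \<phi> + At \<psi> + 1) * 2 ^ Ats ys) (Hol \<gamma> k)"
    using density_Hol[OF k] Ats_level[OF k(1), of \<gamma>, symmetric] l by (simp add: power_add mult_ac)
  have "local_state (At \<phi> + At \<psi> + 1) (meaning ?\<chi>) $$ (i, j) = 0"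
    by (rule local_state_Toffoli_off_diagonal[OF dens reduced refl]) (use assms eq in auto)
  then show ?thesis by (simp add: state_def conj_def)
qed

lemma dim_state [simp]: "dim_row (state \<phi>) = 2" "dim_col (state \<phi>) = 2"
  by (auto simp: state_def)

lemma state_trace: "\<phi> \<in> subforms \<gamma> \<Longrightarrow> state \<phi> $$ (0, 0) + state \<phi> $$ (1, 1) = 1"
  using mtrace_state by (simp add: mtrace_def sum_lessThan_2)

text \<open>With the off-diagonal entries gone and trace 1, one unknown entry is left; orienting the
  trace equation towards it lets the laws for conjunctions close by simplification.\<close>

lemma state_conj_index:
  assumes "conj \<phi> \<psi> \<in> subforms \<gamma>"
  shows "state (conj \<phi> \<psi>) $$ (0, 0) = 1 - state (conj \<phi> \<psi>) $$ (1, 1)"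
    "state (conj \<phi> \<psi>) $$ (0, 1) = 0" "state (conj \<phi> \<psi>) $$ (1, 0) = 0"
  using state_trace[OF assms] state_conj_off_diagonal[OF assms] by (simp_all add: eq_diff_eq)

lemmas state_simps = state_Neg state_SqId state_SqNeg state_FF state_TT state_conj_index dim_state

end

text \<open>Inclusions of the sets \<open>subforms\<close>, rather than memberships, make the
  simplifier list the nested subformulas of a concrete law, as the premises of
  \<open>state_simps\<close> require. Equality of the entries gives both directions of the
  equivalence.\<close>

lemma qequivI:
  assumes "\<And>T Hol \<gamma>. holistic_model T Hol \<Longrightarrow>
    subforms \<phi> \<subseteq> subforms \<gamma> \<Longrightarrow> subforms \<psi> \<subseteq> subforms \<gamma> \<Longrightarrow>
    holistic_model.state T Hol \<gamma> \<phi> $$ (1, 1) = holistic_model.state T Hol \<gamma> \<psi> $$ (1, 1)"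
  shows "\<phi> \<equiv>\<^sub>q \<psi>"
proof -
  have "probT T (At \<phi>) (hol_meaning Hol \<gamma> \<phi>) = probT T (At \<psi>) (hol_meaning Hol \<gamma> \<psi>)"
    if "truth_perspective T" "holistic T Hol" "\<phi> \<in> subforms \<gamma>" "\<psi> \<in> subforms \<gamma>" for T \<gamma> Hol
  proof -
    interpret holistic_model T Hol \<gamma> by unfold_locales (use that in auto)
    show ?thesis using that assms[OF holistic_model_axioms] by (simp add: probT_state)
  qed
  then show ?thesis unfolding qequiv_def consequence_def by (metis order_refl)
qed

theorem theorem5p3:
  fixes \<alpha> \<beta> :: form
  shows "SqId (SqId \<alpha>) \<equiv>\<^sub>q \<alpha>
    \<and> SqId FF \<equiv>\<^sub>q SqId TT
    \<and> (Neg (SqId FF) \<equiv>\<^sub>q SqId FF \<and> Neg (SqId TT) \<equiv>\<^sub>q SqId TT)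
    \<and> SqId (conj \<alpha> \<beta>) \<equiv>\<^sub>q SqId FF
    \<and> SqNeg (SqNeg \<alpha>) \<equiv>\<^sub>q Neg \<alpha>
    \<and> SqNeg FF \<equiv>\<^sub>q SqNeg TT
    \<and> (Neg (SqNeg FF) \<equiv>\<^sub>q SqNeg FF \<and> Neg (SqNeg TT) \<equiv>\<^sub>q SqNeg TT)
    \<and> Neg (SqNeg \<alpha>) \<equiv>\<^sub>q SqNeg (Neg \<alpha>)
    \<and> SqNeg (conj \<alpha> \<beta>) \<equiv>\<^sub>q SqNeg FF
    \<and> SqId (SqNeg \<alpha>) \<equiv>\<^sub>q SqId \<alpha>
    \<and> SqNeg (SqId \<alpha>) \<equiv>\<^sub>q Neg (SqNeg \<alpha>)
    \<and> SqId (SqNeg (conj \<alpha> \<beta>)) \<equiv>\<^sub>q SqNeg FF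
    \<and> SqNeg (SqId (conj \<alpha> \<beta>)) \<equiv>\<^sub>q SqNeg FF"
  \<comment> \<open>Entries of products must be met by the conjugation rules, so the general product
    rule is switched off; removing \<open>One_nat_def\<close> keeps the index 1 in the form of these
    rules.\<close>
  by (intro conjI qequivI)
    (simp_all add: holistic_model.state_simps conjugate_not_mat conjugate_sqrtI_mat
      conjugate_sqrtNOT_mat diag_proj_index field_simps del: index_mult_mat(1) One_nat_def)

end
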